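(* Let $\mathscr U$ be an ultrafilter on $\mathbb N$, let $\{K_i\}_{i\in\mathbb N}$ be fields such that $K=\prod_{\mathscr U}K_i$ is an algebraically closed field, and let $\{\mathcal C_i\}_{i\in\mathbb N}$ be a sequence of small semisimple $K_i$-linear categories. Suppose $\mathcal D$ is a Karoubian, Krull--Schmidt $K$-linear subcategory of $\prod_{\mathscr U}\mathcal C_i$. Then $\mathcal D$ is semisimple. Moreover, $\operatorname{ulim}_iX_i$ is a simple object in $\prod_{\mathscr U}\mathcal C_i$ if and only if $X_i$ is simple for $\mathscr U$-almost every $i$.
   Context: All fields (in particular the $K_i$) are assumed algebraically closed. A $K_i$-linear category is semisimple if it is abelian, has finite-dimensional morphism spaces, and every object is a finite direct sum of simple objects. A category is Karoubian if it is additive and all idempotents split; it is Krull--Schmidt if every object decomposes uniquely (up to order and isomorphism) as a finite direct sum of indecomposable objects with local endomorphism rings. For a sequence of sets $A_i$, the ultraproduct $\prod_{\mathscr U}A_i$ is $\prod_iA_i$ modulo equality on a set of indices belonging to $\mathscr U$; the class of $(a_i)$ is $\operatorname{ulim}_ia_i$. "For $\mathscr U$-almost every $i$" means for all $i$ in some set belonging to $\mathscr U$. The ultraproduct $\prod_{\mathscr U}\mathcal C_i$ of small categories has as objects and morphisms the classes of sequences of objects and morphisms, with all structure defined termwise; it is $K$-linear.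
   Formalization: The subcategory D is assumed to be full; for non-full K-linear subcategories the claim fails, e.g. matrices over K[e]/(e^2) acting on powers of K^2 form a Karoubian, Krull–Schmidt linear subcategory of vector spaces that is not semisimple. *)

theory Defs
  imports
    "HOL-Algebra.Algebraic_Closure"
    "Jordan_Normal_Form.Missing_VectorSpace"
begin

section \<open>Linear categories\<close>

text \<open>
  \<open>Comp g f\<close> is \<open>g\<close> after \<open>f\<close>; it is constrained only for composable arrows, and \<open>Plus\<close> only
  for parallel arrows.
\<close>

record ('o, 'm, 'k) lincat =
  Obj   :: "'o set"
  Arr   :: "'m set"
  Dom   :: "'m \<Rightarrow> 'o"
  Cod   :: "'m \<Rightarrow> 'o"
  Ident :: "'o \<Rightarrow> 'm"
  Comp  :: "'m \<Rightarrow> 'm \<Rightarrow> 'm"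
  Zero  :: "'o \<Rightarrow> 'o \<Rightarrow> 'm"
  Plus  :: "'m \<Rightarrow> 'm \<Rightarrow> 'm"
  Scale :: "'k \<Rightarrow> 'm \<Rightarrow> 'm"

definition Hom :: "('o, 'm, 'k) lincat \<Rightarrow> 'o \<Rightarrow> 'o \<Rightarrow> 'm set" where
  "Hom C A B = {f \<in> Arr C. Dom C f = A \<and> Cod C f = B}"

text \<open>
  \<open>Hom(A, B)\<close> as a module. The multiplicative fields are ignored by \<^locale>\<open>vectorspace\<close>; they are
  filled in so that \<open>hom_space C A A\<close> is also the endomorphism ring of \<open>A\<close>.
\<close>

definition hom_space :: "('o, 'm, 'k) lincat \<Rightarrow> 'o \<Rightarrow> 'o \<Rightarrow> ('k, 'm) module" where
  "hom_space C A B =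
    \<lparr>carrier = Hom C A B, monoid.mult = Comp C, one = Ident C A,
     zero = Zero C A B, add = Plus C, smult = Scale C\<rparr>"

locale linear_category =
  fixes K :: "'k ring" and C :: "('o, 'm, 'k) lincat"
  assumes field: "field K"
    and Dom_in: "f \<in> Arr C \<Longrightarrow> Dom C f \<in> Obj C"
    and Cod_in: "f \<in> Arr C \<Longrightarrow> Cod C f \<in> Obj C"
    and Ident_in: "A \<in> Obj C \<Longrightarrow> Ident C A \<in> Hom C A A"
    and Comp_in: "f \<in> Hom C A B \<Longrightarrow> g \<in> Hom C B E \<Longrightarrow> Comp C g f \<in> Hom C A E"
    and Comp_Ident: "f \<in> Hom C A B \<Longrightarrow> Comp C f (Ident C A) = f"
    and Ident_Comp: "f \<in> Hom C A B \<Longrightarrow> Comp C (Ident C B) f = f"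
    and Comp_assoc: "f \<in> Hom C W A \<Longrightarrow> g \<in> Hom C A B \<Longrightarrow> h \<in> Hom C B E \<Longrightarrow>
      Comp C h (Comp C g f) = Comp C (Comp C h g) f"
    and Hom_vectorspace: "A \<in> Obj C \<Longrightarrow> B \<in> Obj C \<Longrightarrow> vectorspace K (hom_space C A B)"
    and Comp_Plus_right: "f \<in> Hom C A B \<Longrightarrow> f' \<in> Hom C A B \<Longrightarrow> g \<in> Hom C B E \<Longrightarrow>
      Comp C g (Plus C f f') = Plus C (Comp C g f) (Comp C g f')"
    and Comp_Plus_left: "f \<in> Hom C A B \<Longrightarrow> g \<in> Hom C B E \<Longrightarrow> g' \<in> Hom C B E \<Longrightarrow>
      Comp C (Plus C g g') f = Plus C (Comp C g f) (Comp C g' f)"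
    and Comp_Scale_right: "f \<in> Hom C A B \<Longrightarrow> g \<in> Hom C B E \<Longrightarrow> a \<in> carrier K \<Longrightarrow>
      Comp C g (Scale C a f) = Scale C a (Comp C g f)"
    and Comp_Scale_left: "f \<in> Hom C A B \<Longrightarrow> g \<in> Hom C B E \<Longrightarrow> a \<in> carrier K \<Longrightarrow>
      Comp C (Scale C a g) f = Scale C a (Comp C g f)"

definition iso_arr :: "('o, 'm, 'k) lincat \<Rightarrow> 'm \<Rightarrow> bool" where
  "iso_arr C f \<longleftrightarrow> f \<in> Arr C \<and>
    (\<exists>g \<in> Hom C (Cod C f) (Dom C f).
      Comp C g f = Ident C (Dom C f) \<and> Comp C f g = Ident C (Cod C f))"

definition isomorphic :: "('o, 'm, 'k) lincat \<Rightarrow> 'o \<Rightarrow> 'o \<Rightarrow> bool" where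
  "isomorphic C A B \<longleftrightarrow> (\<exists>f \<in> Hom C A B. iso_arr C f)"

definition mono_arr :: "('o, 'm, 'k) lincat \<Rightarrow> 'm \<Rightarrow> bool" where
  "mono_arr C f \<longleftrightarrow> f \<in> Arr C \<and>
    (\<forall>W \<in> Obj C. \<forall>g \<in> Hom C W (Dom C f). \<forall>h \<in> Hom C W (Dom C f).
      Comp C f g = Comp C f h \<longrightarrow> g = h)"

definition epi_arr :: "('o, 'm, 'k) lincat \<Rightarrow> 'm \<Rightarrow> bool" where
  "epi_arr C f \<longleftrightarrow> f \<in> Arr C \<and>
    (\<forall>W \<in> Obj C. \<forall>g \<in> Hom C (Cod C f) W. \<forall>h \<in> Hom C (Cod C f) W.
      Comp C g f = Comp C h f \<longrightarrow> g = h)"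

definition kernel_of :: "('o, 'm, 'k) lincat \<Rightarrow> 'm \<Rightarrow> 'm \<Rightarrow> bool" where
  "kernel_of C f k \<longleftrightarrow> f \<in> Arr C \<and> k \<in> Arr C \<and> Cod C k = Dom C f \<and>
    Comp C f k = Zero C (Dom C k) (Cod C f) \<and>
    (\<forall>W \<in> Obj C. \<forall>h \<in> Hom C W (Dom C f). Comp C f h = Zero C W (Cod C f) \<longrightarrow>
      (\<exists>!u. u \<in> Hom C W (Dom C k) \<and> Comp C k u = h))"

definition cokernel_of :: "('o, 'm, 'k) lincat \<Rightarrow> 'm \<Rightarrow> 'm \<Rightarrow> bool" where
  "cokernel_of C f q \<longleftrightarrow> f \<in> Arr C \<and> q \<in> Arr C \<and> Dom C q = Cod C f \<and>
    Comp C q f = Zero C (Dom C f) (Cod C q) \<and>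
    (\<forall>W \<in> Obj C. \<forall>h \<in> Hom C (Cod C f) W. Comp C h f = Zero C (Dom C f) W \<longrightarrow>
      (\<exists>!u. u \<in> Hom C (Cod C q) W \<and> Comp C u q = h))"

definition zero_object :: "('o, 'm, 'k) lincat \<Rightarrow> 'o \<Rightarrow> bool" where
  "zero_object C A \<longleftrightarrow> A \<in> Obj C \<and>
    (\<forall>B \<in> Obj C. (\<exists>!f. f \<in> Hom C A B) \<and> (\<exists>!f. f \<in> Hom C B A))"

text \<open>\<open>A\<close> is a biproduct of the list \<open>Bs\<close>; for \<open>Bs = []\<close> this says that \<open>A\<close> is a zero object.\<close>

definition direct_sum :: "('o, 'm, 'k) lincat \<Rightarrow> 'o \<Rightarrow> 'o list \<Rightarrow> bool" where
  "direct_sum C A Bs \<longleftrightarrow> A \<in> Obj C \<and> set Bs \<subseteq> Obj C \<and>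
    (\<exists>\<iota> \<pi>.
      (\<forall>k < length Bs. \<iota> k \<in> Hom C (Bs ! k) A \<and> \<pi> k \<in> Hom C A (Bs ! k)) \<and>
      (\<forall>k < length Bs. \<forall>l < length Bs.
        Comp C (\<pi> l) (\<iota> k) = (if k = l then Ident C (Bs ! k) else Zero C (Bs ! k) (Bs ! l))) \<and>
      finsum (hom_space C A A) (\<lambda>k. Comp C (\<iota> k) (\<pi> k)) {..<length Bs} = Ident C A)"

definition additive_category :: "'k ring \<Rightarrow> ('o, 'm, 'k) lincat \<Rightarrow> bool" where
  "additive_category K C \<longleftrightarrow> linear_category K C \<and>
    (\<forall>Bs. set Bs \<subseteq> Obj C \<longrightarrow> (\<exists>A. direct_sum C A Bs))"

definition abelian_category :: "'k ring \<Rightarrow> ('o, 'm, 'k) lincat \<Rightarrow> bool" where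
  "abelian_category K C \<longleftrightarrow> additive_category K C \<and>
    (\<forall>f \<in> Arr C. (\<exists>k. kernel_of C f k) \<and> (\<exists>q. cokernel_of C f q)) \<and>
    (\<forall>f. mono_arr C f \<longrightarrow> (\<exists>g. kernel_of C g f)) \<and>
    (\<forall>f. epi_arr C f \<longrightarrow> (\<exists>g. cokernel_of C g f))"

text \<open>A nonzero object whose only subobjects are zero and the object itself.\<close>

definition simple_object :: "('o, 'm, 'k) lincat \<Rightarrow> 'o \<Rightarrow> bool" where
  "simple_object C A \<longleftrightarrow> A \<in> Obj C \<and> \<not> zero_object C A \<and>
    (\<forall>f. mono_arr C f \<and> Cod C f = A \<longrightarrow> zero_object C (Dom C f) \<or> iso_arr C f)"

definition semisimple_category :: "'k ring \<Rightarrow> ('o, 'm, 'k) lincat \<Rightarrow> bool" where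
  "semisimple_category K C \<longleftrightarrow> abelian_category K C \<and>
    (\<forall>A \<in> Obj C. \<forall>B \<in> Obj C. vectorspace.fin_dim K (hom_space C A B)) \<and>
    (\<forall>A \<in> Obj C. \<exists>Ss. (\<forall>S \<in> set Ss. simple_object C S) \<and> direct_sum C A Ss)"

definition karoubian :: "'k ring \<Rightarrow> ('o, 'm, 'k) lincat \<Rightarrow> bool" where
  "karoubian K C \<longleftrightarrow> additive_category K C \<and>
    (\<forall>A \<in> Obj C. \<forall>e \<in> Hom C A A. Comp C e e = e \<longrightarrow>
      (\<exists>B \<in> Obj C. \<exists>r \<in> Hom C A B. \<exists>s \<in> Hom C B A.
        Comp C r s = Ident C B \<and> Comp C s r = e))"

definition indecomposable_object :: "('o, 'm, 'k) lincat \<Rightarrow> 'o \<Rightarrow> bool" where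
  "indecomposable_object C A \<longleftrightarrow> A \<in> Obj C \<and> \<not> zero_object C A \<and>
    (\<forall>B E. direct_sum C A [B, E] \<longrightarrow> zero_object C B \<or> zero_object C E)"

text \<open>
  Not necessarily commutative local rings: the non-units form a (two-sided) ideal.
  The zero ring is excluded, as its carrier has no non-unit.
\<close>

definition local_ring :: "('a, 'b) ring_scheme \<Rightarrow> bool" where
  "local_ring R \<longleftrightarrow> ring R \<and> ideal (carrier R - Units R) R"

definition krull_schmidt_decomp :: "('o, 'm, 'k) lincat \<Rightarrow> 'o \<Rightarrow> 'o list \<Rightarrow> bool" where
  "krull_schmidt_decomp C A Bs \<longleftrightarrow> direct_sum C A Bs \<and>
    (\<forall>B \<in> set Bs. indecomposable_object C B \<and> local_ring (hom_space C B B))"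

definition krull_schmidt :: "('o, 'm, 'k) lincat \<Rightarrow> bool" where
  "krull_schmidt C \<longleftrightarrow>
    (\<forall>A \<in> Obj C. (\<exists>Bs. krull_schmidt_decomp C A Bs) \<and>
      (\<forall>Bs Es. krull_schmidt_decomp C A Bs \<and> krull_schmidt_decomp C A Es \<longrightarrow>
        rel_mset (isomorphic C) (mset Bs) (mset Es)))"

definition linear_subcategory ::
    "'k ring \<Rightarrow> ('o, 'm, 'k) lincat \<Rightarrow> ('o, 'm, 'k) lincat \<Rightarrow> bool" where
  "linear_subcategory K D C \<longleftrightarrow> linear_category K D \<and>
    Obj D \<subseteq> Obj C \<and> Arr D \<subseteq> Arr C \<and>
    (\<forall>f \<in> Arr D. Dom D f = Dom C f \<and> Cod D f = Cod C f) \<and>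
    (\<forall>A \<in> Obj D. Ident D A = Ident C A) \<and>
    (\<forall>f \<in> Arr D. \<forall>g \<in> Arr D. Dom D g = Cod D f \<longrightarrow> Comp D g f = Comp C g f) \<and>
    (\<forall>A \<in> Obj D. \<forall>B \<in> Obj D. Zero D A B = Zero C A B) \<and>
    (\<forall>f \<in> Arr D. \<forall>g \<in> Arr D. Dom D f = Dom D g \<and> Cod D f = Cod D g \<longrightarrow>
      Plus D f g = Plus C f g) \<and>
    (\<forall>a \<in> carrier K. \<forall>f \<in> Arr D. Scale D a f = Scale C a f)"

text \<open>
  Fullness matters below: the matrices over the dual numbers \<open>K[e]/(e^2)\<close>, acting on powers of
  \<open>K^2\<close>, form a non-full Karoubian Krull-Schmidt linear subcategory of vector spaces that is not
  semisimple.
\<close>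

definition full_linear_subcategory ::
    "'k ring \<Rightarrow> ('o, 'm, 'k) lincat \<Rightarrow> ('o, 'm, 'k) lincat \<Rightarrow> bool" where
  "full_linear_subcategory K D C \<longleftrightarrow> linear_subcategory K D C \<and>
    (\<forall>A \<in> Obj D. \<forall>B \<in> Obj D. Hom D A B = Hom C A B)"


section \<open>Ultraproducts\<close>

locale ultrafilter =
  fixes U :: "'i filter"
  assumes proper: "U \<noteq> bot"
    and ultra: "eventually P U \<or> eventually (\<lambda>i. \<not> P i) U"

text \<open>
  The class of a sequence is taken among all sequences of the ambient type, so it also contains
  sequences that leave the sets \<open>A i\<close> outside a set of the ultrafilter. Intersecting with the
  product of the \<open>A i\<close> identifies \<open>ultraproduct U A\<close> with that product modulo equality on a set of
  the ultrafilter. The advantage is that \<open>ulim U a\<close> makes sense when \<open>a i \<in> A i\<close> holds only almost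
  everywhere, as happens for the termwise composite of classes of composable arrows.
\<close>

definition ulim :: "'i filter \<Rightarrow> ('i \<Rightarrow> 'a) \<Rightarrow> ('i \<Rightarrow> 'a) set" where
  "ulim U a = {b. \<forall>\<^sub>F i in U. b i = a i}"

definition ultraproduct :: "'i filter \<Rightarrow> ('i \<Rightarrow> 'a set) \<Rightarrow> ('i \<Rightarrow> 'a) set set" where
  "ultraproduct U A = {ulim U a | a. \<forall>i. a i \<in> A i}"

definition urep :: "('i \<Rightarrow> 'a) set \<Rightarrow> 'i \<Rightarrow> 'a" where
  "urep x = (SOME a. a \<in> x)"

definition ulift :: "'i filter \<Rightarrow> ('i \<Rightarrow> 'a \<Rightarrow> 'b) \<Rightarrow> ('i \<Rightarrow> 'a) set \<Rightarrow> ('i \<Rightarrow> 'b) set" where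
  "ulift U F x = ulim U (\<lambda>i. F i (urep x i))"

definition ulift2 ::
    "'i filter \<Rightarrow> ('i \<Rightarrow> 'a \<Rightarrow> 'b \<Rightarrow> 'c) \<Rightarrow> ('i \<Rightarrow> 'a) set \<Rightarrow> ('i \<Rightarrow> 'b) set \<Rightarrow> ('i \<Rightarrow> 'c) set" where
  "ulift2 U F x y = ulim U (\<lambda>i. F i (urep x i) (urep y i))"

definition ultraproduct_ring :: "'i filter \<Rightarrow> ('i \<Rightarrow> 'k ring) \<Rightarrow> ('i \<Rightarrow> 'k) set ring" where
  "ultraproduct_ring U K =
    \<lparr>carrier = ultraproduct U (\<lambda>i. carrier (K i)),
     monoid.mult = ulift2 U (\<lambda>i. monoid.mult (K i)),
     one = ulim U (\<lambda>i. one (K i)),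
     zero = ulim U (\<lambda>i. zero (K i)),
     add = ulift2 U (\<lambda>i. add (K i))\<rparr>"

definition ultraproduct_cat ::
    "'i filter \<Rightarrow> ('i \<Rightarrow> ('o, 'm, 'k) lincat) \<Rightarrow>
      (('i \<Rightarrow> 'o) set, ('i \<Rightarrow> 'm) set, ('i \<Rightarrow> 'k) set) lincat" where
  "ultraproduct_cat U C =
    \<lparr>Obj = ultraproduct U (\<lambda>i. Obj (C i)),
     Arr = ultraproduct U (\<lambda>i. Arr (C i)),
     Dom = ulift U (\<lambda>i. Dom (C i)),
     Cod = ulift U (\<lambda>i. Cod (C i)),
     Ident = ulift U (\<lambda>i. Ident (C i)),
     Comp = ulift2 U (\<lambda>i. Comp (C i)),
     Zero = ulift2 U (\<lambda>i. Zero (C i)),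
     Plus = ulift2 U (\<lambda>i. Plus (C i)),
     Scale = ulift2 U (\<lambda>i. Scale (C i))\<rparr>"

text \<open>The lifted operations do not depend on the chosen representatives.\<close>

lemma ulim_eq_iff: "ulim U a = ulim U b \<longleftrightarrow> (\<forall>\<^sub>F i in U. a i = b i)"
proof
  assume "ulim U a = ulim U b"
  moreover have "a \<in> ulim U a" by (simp add: ulim_def)
  ultimately show "\<forall>\<^sub>F i in U. a i = b i" by (simp add: ulim_def)
next
  assume ab: "\<forall>\<^sub>F i in U. a i = b i"
  have "(\<forall>\<^sub>F i in U. c i = a i) \<longleftrightarrow> (\<forall>\<^sub>F i in U. c i = b i)" for c
    using ab by (auto elim: eventually_elim2)
  then show "ulim U a = ulim U b" by (simp add: ulim_def)
qed

lemma urep_ulim: "\<forall>\<^sub>F i in U. urep (ulim U a) i = a i"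
proof -
  have "a \<in> ulim U a" by (simp add: ulim_def)
  then have "urep (ulim U a) \<in> ulim U a" unfolding urep_def by (rule someI[of "\<lambda>b. b \<in> ulim U a"])
  then show ?thesis by (simp add: ulim_def)
qed

lemma ulift_ulim: "ulift U F (ulim U a) = ulim U (\<lambda>i. F i (a i))"
  unfolding ulift_def ulim_eq_iff using urep_ulim[of U a] by (rule eventually_mono) simp

lemma ulift2_ulim: "ulift2 U F (ulim U a) (ulim U b) = ulim U (\<lambda>i. F i (a i) (b i))"
  unfolding ulift2_def ulim_eq_iff using urep_ulim[of U a] urep_ulim[of U b]
  by (rule eventually_elim2) simp

end

theory Submission
  imports Defs
begin

text \<open>
  An arrow \<open>f\<close> is called von Neumann regular if \<open>f g f = f\<close> for some \<open>g\<close> in the opposite direction. Every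
  arrow of a semisimple category is regular, by Gaussian elimination on its matrix with respect to
  decompositions into simple objects (\<open>semisimple_regular\<close>). Regularity passes to the ultraproduct
  by choosing the quasi-inverses termwise, and then to a full subcategory \<open>D\<close>.

  In a Karoubian category all of whose arrows are regular, kernels and cokernels are obtained by
  splitting the idempotents \<open>1 - g f\<close> and \<open>1 - f g\<close>, so \<open>D\<close> is abelian (\<open>abelian_if_regular\<close>). The
  summands of a Krull-Schmidt decomposition have local endomorphism rings. A local ring in which
  every element is regular is a division ring (\<open>local_regular_unit\<close>), and an object whose endomorphisms
  form a division ring is simple if all arrows are regular (\<open>simple_if_division\<close>). Thus every object
  of \<open>D\<close> is a finite direct sum of simple objects.

  For the finiteness of the Hom spaces, let \<open>S = ulim S i\<close> be one of these simple objects. For almost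
  every \<open>i\<close> the nonzero endomorphisms of \<open>S i\<close> are invertible, whence they are scalars by Schur's lemma
  over the algebraically closed field \<open>K i\<close>, and so all endomorphisms of \<open>S\<close> are scalars
  (\<open>UC_Schur\<close>). Hence Hom spaces between the simple summands are at most one-dimensional, and those
  between their finite direct sums are finite-dimensional (\<open>fin_dim_Hom\<close>).

  The assertion on simple objects of the ultraproduct is an instance of the theorem of Los:
  being a zero object, a monomorphism, an isomorphism, or a simple object is expressed by quantifying
  over objects and arrows only (\<open>Los_simple_object\<close>).
\<close>

section \<open>Finite-dimensional algebras over algebraically closed fields\<close>

text \<open>
  A unital associative algebra over a field. The multiplication need not be commutative, unlike in
  the locale \<^locale>\<open>algebra\<close>.
\<close>

locale field_algebra = vectorspace K E + E?: ring E
  for K :: "'k ring" and E :: "('k, 'm) module" +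
  assumes smult_mult_left: "a \<in> carrier K \<Longrightarrow> x \<in> carrier E \<Longrightarrow> y \<in> carrier E \<Longrightarrow>
      (a \<odot>\<^bsub>E\<^esub> x) \<otimes>\<^bsub>E\<^esub> y = a \<odot>\<^bsub>E\<^esub> (x \<otimes>\<^bsub>E\<^esub> y)"
    and smult_mult_right: "a \<in> carrier K \<Longrightarrow> x \<in> carrier E \<Longrightarrow> y \<in> carrier E \<Longrightarrow>
      x \<otimes>\<^bsub>E\<^esub> (a \<odot>\<^bsub>E\<^esub> y) = a \<odot>\<^bsub>E\<^esub> (x \<otimes>\<^bsub>E\<^esub> y)"
begin

text \<open>
  Evaluation at \<open>x\<close> of a polynomial over \<open>K\<close>, given by the list of its coefficients with the
  leading one first. Leading zeros are harmless, so that sums can be formed entrywise on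
  lists of equal length.
\<close>

fun eval_at :: "'m \<Rightarrow> 'k list \<Rightarrow> 'm" where
  "eval_at x [] = \<zero>\<^bsub>E\<^esub>"
| "eval_at x (c # p) = c \<odot>\<^bsub>E\<^esub> (x [^]\<^bsub>E\<^esub> length p) \<oplus>\<^bsub>E\<^esub> eval_at x p"

lemma eval_at_closed [simp]:
  "x \<in> carrier E \<Longrightarrow> set p \<subseteq> carrier K \<Longrightarrow> eval_at x p \<in> carrier E"
  by (induction p) auto

lemma eval_at_snoc:
  assumes "x \<in> carrier E" "set p \<subseteq> carrier K" "c \<in> carrier K"
  shows "eval_at x (p @ [c]) = x \<otimes>\<^bsub>E\<^esub> eval_at x p \<oplus>\<^bsub>E\<^esub> c \<odot>\<^bsub>E\<^esub> \<one>\<^bsub>E\<^esub>"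
  using assms(2)
proof (induction p)
  case Nil
  then show ?case using assms by simp
next
  case (Cons d p)
  have pow: "x [^]\<^bsub>E\<^esub> Suc (length p) = x \<otimes>\<^bsub>E\<^esub> x [^]\<^bsub>E\<^esub> length p"
    using assms(1) E.nat_pow_Suc2 by blast
  show ?case
    using Cons assms(1,3) pow
    by (simp add: E.r_distr smult_mult_right M.add.m_assoc del: E.nat_pow_Suc)
qed

lemma eval_at_add:
  assumes "x \<in> carrier E" "set p \<subseteq> carrier K" "set q \<subseteq> carrier K" "length p = length q"
  shows "eval_at x (map2 (\<oplus>\<^bsub>K\<^esub>) p q) = eval_at x p \<oplus>\<^bsub>E\<^esub> eval_at x q"
  using assms(4,2,3)
proof (induction p q rule: list_induct2)
  case (Cons c p d q)
  then show ?case
    using assms(1) by (simp add: smult_l_distr M.add.m_ac)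
qed (use assms in simp)

lemma eval_at_smult:
  assumes "x \<in> carrier E" "set p \<subseteq> carrier K" "a \<in> carrier K"
  shows "eval_at x (map ((\<otimes>\<^bsub>K\<^esub>) a) p) = a \<odot>\<^bsub>E\<^esub> eval_at x p"
  using assms(2) by (induction p) (use assms in \<open>auto simp: smult_r_distr smult_assoc1\<close>)

lemma eval_at_power:
  assumes "x \<in> carrier E" "i < n"
  shows "\<exists>p. set p \<subseteq> carrier K \<and> length p = n \<and> eval_at x p = x [^]\<^bsub>E\<^esub> i"
  using assms(2)
proof (induction n)
  case (Suc n)
  have zero: "eval_at x (replicate m \<zero>\<^bsub>K\<^esub>) = \<zero>\<^bsub>E\<^esub>" for m
    using assms(1) by (induction m) auto
  show ?case
  proof (cases "i = n")
    case True
    show ?thesis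
      by (rule exI[of _ "\<one>\<^bsub>K\<^esub> # replicate n \<zero>\<^bsub>K\<^esub>"]) (use True assms(1) in \<open>auto simp: zero\<close>)
  next
    case False
    then obtain p where "set p \<subseteq> carrier K" "length p = n" "eval_at x p = x [^]\<^bsub>E\<^esub> i"
      using Suc by auto
    then show ?thesis
      by (intro exI[of _ "\<zero>\<^bsub>K\<^esub> # p"]) (use assms(1) in auto)
  qed
qed simp

lemma span_powers_subset:
  assumes x: "x \<in> carrier E"
  shows "span ((\<lambda>i. x [^]\<^bsub>E\<^esub> i) ` {..<n}) \<subseteq> {eval_at x p | p. set p \<subseteq> carrier K \<and> length p = n}"
proof (rule span_is_subset)
  let ?P = "{eval_at x p | p. set p \<subseteq> carrier K \<and> length p = n}"
  show "(\<lambda>i. x [^]\<^bsub>E\<^esub> i) ` {..<n} \<subseteq> ?P"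
    using eval_at_power[OF x] by (auto simp: image_iff) metis
  show "submodule K ?P E"
  proof (rule submodule.intro)
    show "module K E" by (rule module_axioms)
    show "?P \<subseteq> carrier E" using x by auto
    show "\<zero>\<^bsub>E\<^esub> \<in> ?P"
    proof -
      have "eval_at x (replicate n \<zero>\<^bsub>K\<^esub>) = \<zero>\<^bsub>E\<^esub>"
        using x by (induction n) auto
      then show ?thesis by (auto intro!: exI[of _ "replicate n \<zero>\<^bsub>K\<^esub>"])
    qed
  next
    fix v w assume "v \<in> ?P" "w \<in> ?P"
    then obtain p q where pq: "v = eval_at x p" "w = eval_at x q" "set p \<subseteq> carrier K"
        "set q \<subseteq> carrier K" "length p = n" "length q = n"
      by auto
    have "set (map2 (\<oplus>\<^bsub>K\<^esub>) p q) \<subseteq> carrier K"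
      using pq(3,4) by (auto intro!: R.add.m_closed dest: set_zip_leftD set_zip_rightD)
    then show "v \<oplus>\<^bsub>E\<^esub> w \<in> ?P"
      using pq eval_at_add[OF x pq(3,4)] by (auto intro!: exI[of _ "map2 (\<oplus>\<^bsub>K\<^esub>) p q"])
  next
    fix c v assume c: "c \<in> carrier K" and "v \<in> ?P"
    then obtain p where p: "v = eval_at x p" "set p \<subseteq> carrier K" "length p = n"
      by auto
    have "set (map ((\<otimes>\<^bsub>K\<^esub>) c) p) \<subseteq> carrier K" using p(2) c by auto
    then show "c \<odot>\<^bsub>E\<^esub> v \<in> ?P"
      using p c eval_at_smult[OF x p(2) c] by (auto intro!: exI[of _ "map ((\<otimes>\<^bsub>K\<^esub>) c) p"])
  qed
qed

text \<open>
  In a finite-dimensional algebra some power \<open>x^n\<close> lies in the span of the lower powers, since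
  otherwise all the sets of the first \<open>n\<close> powers would be linearly independent.
\<close>

lemma exists_annihilating_poly:
  assumes x: "x \<in> carrier E" and fd: fin_dim
  shows "\<exists>p. p \<noteq> [] \<and> set p \<subseteq> carrier K \<and> hd p \<noteq> \<zero>\<^bsub>K\<^esub> \<and> eval_at x p = \<zero>\<^bsub>E\<^esub>"
proof -
  let ?S = "\<lambda>n. (\<lambda>i. x [^]\<^bsub>E\<^esub> i) ` {..<n::nat}"
  have S: "?S n \<subseteq> carrier E" for n using x by auto
  have "\<exists>n. x [^]\<^bsub>E\<^esub> n \<in> span (?S n)"
  proof (rule ccontr)
    assume neg: "\<not> ?thesis"
    have "lin_indpt (?S n) \<and> card (?S n) = n" for n
    proof (induction n)
      case 0
      show ?case by (simp add: lin_dep_def)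
    next
      case (Suc n)
      have ins: "?S (Suc n) = ?S n \<union> {x [^]\<^bsub>E\<^esub> n}"
        by (simp only: lessThan_Suc image_insert insert_is_Un[symmetric] Un_commute[of _ "{_}"])
      have span: "x [^]\<^bsub>E\<^esub> n \<notin> span (?S n)" using neg by blast
      then have notin: "x [^]\<^bsub>E\<^esub> n \<notin> ?S n"
        using in_own_span[OF S[of n]] by blast
      have "lin_indpt (?S n \<union> {x [^]\<^bsub>E\<^esub> n})"
        using lin_dep_iff_in_span[OF S[of n] _ E.nat_pow_closed[OF x] notin] Suc.IH span by blast
      moreover have "card (?S n \<union> {x [^]\<^bsub>E\<^esub> n}) = Suc n"
        using card_insert_disjoint[OF finite_imageI[OF finite_lessThan] notin] Suc.IH
        by (simp only: Un_insert_right Un_empty_right)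
      ultimately show ?case unfolding ins by blast
    qed
    then have "Suc (vectorspace.dim K E) \<le> vectorspace.dim K E"
      using li_le_dim(2)[OF fd S[of "Suc (vectorspace.dim K E)"]] by simp
    then show False by simp
  qed
  then obtain n p where p: "set p \<subseteq> carrier K" "length p = n" "x [^]\<^bsub>E\<^esub> n = eval_at x p"
    using span_powers_subset[OF x] by blast
  have pow: "x [^]\<^bsub>E\<^esub> n \<in> carrier E" using x by simp
  have "eval_at x ((\<ominus>\<^bsub>K\<^esub> \<one>\<^bsub>K\<^esub>) # p) = \<ominus>\<^bsub>E\<^esub> (x [^]\<^bsub>E\<^esub> n) \<oplus>\<^bsub>E\<^esub> x [^]\<^bsub>E\<^esub> n"
    using smult_l_minus[OF R.one_closed pow] smult_one[OF pow] by (simp add: p(2) flip: p(3))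
  then have "eval_at x ((\<ominus>\<^bsub>K\<^esub> \<one>\<^bsub>K\<^esub>) # p) = \<zero>\<^bsub>E\<^esub>" using M.l_neg[OF pow] by simp
  moreover have "\<ominus>\<^bsub>K\<^esub> \<one>\<^bsub>K\<^esub> \<noteq> \<zero>\<^bsub>K\<^esub>" 
    using R.add.inv_eq_1_iff[OF R.one_closed] by simp
  ultimately show ?thesis
    using p(1) R.a_inv_closed[OF R.one_closed]
    by (intro exI[of _ "(\<ominus>\<^bsub>K\<^esub> \<one>\<^bsub>K\<^esub>) # p"]) (simp del: eval_at.simps)
qed

text \<open>
  Synthetic division by \<open>X - a\<close>, with the identity stated after evaluation at \<open>x\<close>. The remainder is
  the value of \<open>p\<close> at \<open>a\<close>, and a nonconstant \<open>p\<close> has the same leading coefficient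
  as the quotient.
\<close>

lemma eval_at_divide:
  assumes x: "x \<in> carrier E" and a: "a \<in> carrier K" and p: "set p \<subseteq> carrier K"
  shows "\<exists>q. set q \<subseteq> carrier K \<and> length q = length p - 1 \<and> (length p \<ge> 2 \<longrightarrow> hd q = hd p) \<and>
    eval_at x p = (x \<ominus>\<^bsub>E\<^esub> a \<odot>\<^bsub>E\<^esub> \<one>\<^bsub>E\<^esub>) \<otimes>\<^bsub>E\<^esub> eval_at x q \<oplus>\<^bsub>E\<^esub> ring.eval K p a \<odot>\<^bsub>E\<^esub> \<one>\<^bsub>E\<^esub>"
  using p
proof (induction p rule: rev_induct)
  case Nil
  have "x \<ominus>\<^bsub>E\<^esub> a \<odot>\<^bsub>E\<^esub> \<one>\<^bsub>E\<^esub> \<in> carrier E" using x a by simp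
  then show ?case by (intro exI[of _ "[]"]) simp
next
  case (snoc c p)
  define y where "y = x \<ominus>\<^bsub>E\<^esub> a \<odot>\<^bsub>E\<^esub> \<one>\<^bsub>E\<^esub>"
  define e where "e = ring.eval K p a"
  have p: "set p \<subseteq> carrier K" and c: "c \<in> carrier K" using snoc.prems by auto
  then obtain q where q: "set q \<subseteq> carrier K" "length q = length p - 1"
      "length p \<ge> 2 \<longrightarrow> hd q = hd p"
      "eval_at x p = y \<otimes>\<^bsub>E\<^esub> eval_at x q \<oplus>\<^bsub>E\<^esub> e \<odot>\<^bsub>E\<^esub> \<one>\<^bsub>E\<^esub>"
    using snoc.IH unfolding y_def e_def by blast
  have e: "e \<in> carrier K" unfolding e_def by (rule R.eval_in_carrier[OF p a])
  have ev: "ring.eval K (p @ [c]) a = e \<otimes>\<^bsub>K\<^esub> a \<oplus>\<^bsub>K\<^esub> c"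
    unfolding e_def by (rule R.eval_append_aux[OF p c a])
  define u where "u = a \<odot>\<^bsub>E\<^esub> \<one>\<^bsub>E\<^esub>"
  have u: "u \<in> carrier E" "x \<otimes>\<^bsub>E\<^esub> u = u \<otimes>\<^bsub>E\<^esub> x"
    using x a by (simp_all add: u_def smult_mult_left smult_mult_right)
  have yu: "y = x \<oplus>\<^bsub>E\<^esub> \<ominus>\<^bsub>E\<^esub> u" unfolding y_def u_def a_minus_def ..
  have y: "y \<in> carrier E" using x u(1) by (simp add: yu)
  have Q: "eval_at x q \<in> carrier E" using x q(1) by simp
  have "x = y \<oplus>\<^bsub>E\<^esub> u"
    using x u(1) by (simp add: yu M.add.m_assoc M.l_neg)
  then have y_a: "x = y \<oplus>\<^bsub>E\<^esub> a \<odot>\<^bsub>E\<^esub> \<one>\<^bsub>E\<^esub>" unfolding u_def .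
  have xy: "x \<otimes>\<^bsub>E\<^esub> y = y \<otimes>\<^bsub>E\<^esub> x"
    using x u unfolding yu by (simp add: E.r_distr E.l_distr E.r_minus E.l_minus)
  show ?case
  proof (cases "p = []")
    case True
    have "c \<odot>\<^bsub>E\<^esub> \<one>\<^bsub>E\<^esub> \<in> carrier E" using c by simp
    moreover have "ring.eval K (p @ [c]) a = c" using True c a by simp
    moreover have "eval_at x (p @ [c]) = c \<odot>\<^bsub>E\<^esub> \<one>\<^bsub>E\<^esub>" using True c by simp
    moreover have "y \<otimes>\<^bsub>E\<^esub> \<zero>\<^bsub>E\<^esub> = \<zero>\<^bsub>E\<^esub>" using y by simp
    ultimately show ?thesis unfolding y_def[symmetric] using True
      by (intro exI[of _ "[]"]) simp
  next
    case False
    \<comment> \<open>Horner's scheme: the next coefficient of the quotient is the previous remainder.\<close>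
    have hd: "hd (q @ [e]) = hd (p @ [c])"
    proof (cases "q = []")
      case True
      then have "length p = Suc 0" using False q(2) by (cases p) auto
      then obtain d where "p = [d]" by (auto simp: length_Suc_conv)
      then show ?thesis using True p by (simp add: e_def)
    next
      case nonempty: False
      then have "length p \<ge> 2" using q(2) by (cases q) auto
      then show ?thesis using nonempty False q(3) by simp
    qed
    have "x \<otimes>\<^bsub>E\<^esub> eval_at x p = y \<otimes>\<^bsub>E\<^esub> (x \<otimes>\<^bsub>E\<^esub> eval_at x q) \<oplus>\<^bsub>E\<^esub> e \<odot>\<^bsub>E\<^esub> x"
      unfolding q(4) using x y e Q xy
      by (simp add: E.r_distr smult_mult_right E.m_assoc[symmetric])
    also have "e \<odot>\<^bsub>E\<^esub> x = e \<odot>\<^bsub>E\<^esub> y \<oplus>\<^bsub>E\<^esub> (e \<otimes>\<^bsub>K\<^esub> a) \<odot>\<^bsub>E\<^esub> \<one>\<^bsub>E\<^esub>"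
      using y e a by (subst y_a) (simp add: smult_r_distr smult_assoc1)
    finally have "eval_at x (p @ [c]) = y \<otimes>\<^bsub>E\<^esub> eval_at x (q @ [e]) \<oplus>\<^bsub>E\<^esub>
        (e \<otimes>\<^bsub>K\<^esub> a \<oplus>\<^bsub>K\<^esub> c) \<odot>\<^bsub>E\<^esub> \<one>\<^bsub>E\<^esub>"
      using x y e a c p q(1) Q
      by (simp add: eval_at_snoc E.r_distr smult_mult_right smult_l_distr M.add.m_assoc)
    moreover have "set (q @ [e]) \<subseteq> carrier K" using q(1) e by simp
    moreover have "length (q @ [e]) = length (p @ [c]) - 1" using q(2) False by (cases p) auto
    ultimately show ?thesis using hd unfolding ev y_def
      by (intro exI[of _ "q @ [e]"] conjI impI)
  qed
qed

text \<open>
  The algebraic content of Schur's lemma: an annihilating polynomial of \<open>x\<close> splits into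
  linear factors, and one of the factors \<open>x - a\<close> must vanish.
\<close>

lemma scalar_if_no_zero_divisors:
  assumes alg_closed: "algebraically_closed K" and fd: fin_dim
    and nontrivial: "\<one>\<^bsub>E\<^esub> \<noteq> \<zero>\<^bsub>E\<^esub>"
    and integral: "\<And>u v. u \<in> carrier E \<Longrightarrow> v \<in> carrier E \<Longrightarrow> u \<otimes>\<^bsub>E\<^esub> v = \<zero>\<^bsub>E\<^esub> \<Longrightarrow>
      u = \<zero>\<^bsub>E\<^esub> \<or> v = \<zero>\<^bsub>E\<^esub>"
    and x: "x \<in> carrier E"
  shows "\<exists>a \<in> carrier K. x = a \<odot>\<^bsub>E\<^esub> \<one>\<^bsub>E\<^esub>"
proof -
  have "\<exists>a \<in> carrier K. x = a \<odot>\<^bsub>E\<^esub> \<one>\<^bsub>E\<^esub>"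
    if "p \<noteq> []" "set p \<subseteq> carrier K" "hd p \<noteq> \<zero>\<^bsub>K\<^esub>" "eval_at x p = \<zero>\<^bsub>E\<^esub>" for p
    using that
  proof (induction "length p" arbitrary: p rule: less_induct)
    case less
    show ?case
    proof (cases "length p \<ge> 2")
      case False
      then have "length p = Suc 0" using less.prems(1) by (cases p) (auto simp: Suc_le_eq)
      then obtain c where p: "p = [c]" by (auto simp: length_Suc_conv)
      then have c: "c \<in> carrier K" "c \<noteq> \<zero>\<^bsub>K\<^esub>" "c \<odot>\<^bsub>E\<^esub> \<one>\<^bsub>E\<^esub> = \<zero>\<^bsub>E\<^esub>"
        using less.prems by auto
      have "\<one>\<^bsub>E\<^esub> = inv\<^bsub>K\<^esub> c \<odot>\<^bsub>E\<^esub> \<zero>\<^bsub>E\<^esub>"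
        by (rule mult_inverse[OF c(1) _ c(3) c(2)]) simp
      also have "\<dots> = \<zero>\<^bsub>E\<^esub>" using c(1,2) by (simp add: field_Units)
      finally show ?thesis using nontrivial by simp
    next
      case True
      have pK: "p \<in> carrier (poly_ring K)"
        using less.prems by (auto simp: univ_poly_carrier[symmetric] polynomial_def)
      have "R.splitted p" using algebraically_closed.roots_over_carrier[OF alg_closed pK] .
      then have "R.roots p \<noteq> {#}" using True unfolding R.splitted_def by auto
      then obtain a where "a \<in># R.roots p" by blast
      then have "R.is_root p a" using roots_mem_iff_is_root[OF pK] by auto
      then have a: "a \<in> carrier K" "ring.eval K p a = \<zero>\<^bsub>K\<^esub>" unfolding R.is_root_def by auto
      define y where "y = x \<ominus>\<^bsub>E\<^esub> a \<odot>\<^bsub>E\<^esub> \<one>\<^bsub>E\<^esub>"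
      have y: "y \<in> carrier E" using x a by (simp add: y_def)
      obtain q where q: "set q \<subseteq> carrier K" "length q = length p - 1" "hd q = hd p"
          "eval_at x p = y \<otimes>\<^bsub>E\<^esub> eval_at x q"
        using eval_at_divide[OF x a(1) less.prems(2)] True a(2) x y unfolding y_def by auto
      have "y = \<zero>\<^bsub>E\<^esub> \<or> eval_at x q = \<zero>\<^bsub>E\<^esub>"
        using integral[OF y, of "eval_at x q"] q(1,4) x less.prems(4) by simp
      then show ?thesis
      proof
        assume "y = \<zero>\<^bsub>E\<^esub>"
        then have "x = a \<odot>\<^bsub>E\<^esub> \<one>\<^bsub>E\<^esub>" using x a(1) unfolding y_def by (simp add: E.r_right_minus_eq)
        then show ?thesis using a(1) by blast
      next
        assume "eval_at x q = \<zero>\<^bsub>E\<^esub>"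
        then show ?thesis using less.hyps[of q] q True less.prems(3) by (cases q) auto
      qed
    qed
  qed
  then show ?thesis using exists_annihilating_poly[OF x fd] by blast
qed

end

section \<open>Calculus of arrows in a linear category\<close>

lemma carrier_hom_space [simp]: "carrier (hom_space C A B) = Hom C A B"
  and add_hom_space [simp]: "add (hom_space C A B) = Plus C"
  and zero_hom_space [simp]: "zero (hom_space C A B) = Zero C A B"
  and mult_hom_space [simp]: "monoid.mult (hom_space C A B) = Comp C"
  and one_hom_space [simp]: "one (hom_space C A B) = Ident C A"
  and smult_hom_space [simp]: "smult (hom_space C A B) = Scale C"
  by (simp_all add: hom_space_def)

text \<open>
  In the locale below, typing of arrows is expressed by equations between \<^const>\<open>Dom\<close> and \<^const>\<open>Cod\<close>
  rather than by membership in \<^const>\<open>Hom\<close>: the side conditions of the rules then contain no objects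
  that the simplifier would have to guess, and \<open>lin_simps\<close> normalises sums of composites.
\<close>

context linear_category
begin

text \<open>
  The additive inverse of an arrow. Defining it through the scalar \<open>-1\<close> avoids naming the
  Hom space in which it is taken.
\<close>

definition Neg :: "'m \<Rightarrow> 'm" where
  "Neg f = Scale C (\<ominus>\<^bsub>K\<^esub> \<one>\<^bsub>K\<^esub>) f"

lemma HomI: "f \<in> Arr C \<Longrightarrow> Dom C f = A \<Longrightarrow> Cod C f = B \<Longrightarrow> f \<in> Hom C A B"
  by (simp add: Hom_def)

lemma Hom_Obj:
  assumes "f \<in> Hom C A B" shows "A \<in> Obj C" "B \<in> Obj C"
  using assms Dom_in Cod_in by (auto simp: Hom_def)

lemma hom_vs:
  assumes "f \<in> Arr C" shows "vectorspace K (hom_space C (Dom C f) (Cod C f))"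
  using Hom_vectorspace Dom_in[OF assms] Cod_in[OF assms] by blast

lemma minus_one: "\<ominus>\<^bsub>K\<^esub> \<one>\<^bsub>K\<^esub> \<in> carrier K"
proof -
  interpret K: field K by (rule field)
  show ?thesis by simp
qed

lemma Ident_arr:
  "A \<in> Obj C \<Longrightarrow> Ident C A \<in> Arr C"
  "A \<in> Obj C \<Longrightarrow> Dom C (Ident C A) = A"
  "A \<in> Obj C \<Longrightarrow> Cod C (Ident C A) = A"
  using Ident_in by (auto simp: Hom_def)

lemma Comp_arr:
  assumes "f \<in> Arr C" "g \<in> Arr C" "Dom C g = Cod C f"
  shows "Comp C g f \<in> Arr C" "Dom C (Comp C g f) = Dom C f" "Cod C (Comp C g f) = Cod C g"
  using Comp_in[of f "Dom C f" "Cod C f" g "Cod C g"] assms by (auto simp: Hom_def)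

lemma Zero_arr:
  assumes "A \<in> Obj C" "B \<in> Obj C"
  shows "Zero C A B \<in> Arr C" "Dom C (Zero C A B) = A" "Cod C (Zero C A B) = B"
proof -
  interpret V: vectorspace K "hom_space C A B" using Hom_vectorspace assms by blast
  have "Zero C A B \<in> Hom C A B" using V.M.zero_closed by simp
  then show "Zero C A B \<in> Arr C" "Dom C (Zero C A B) = A" "Cod C (Zero C A B) = B"
    by (auto simp: Hom_def)
qed

lemma Plus_arr:
  assumes "f \<in> Arr C" "g \<in> Arr C" "Dom C g = Dom C f" "Cod C g = Cod C f"
  shows "Plus C f g \<in> Arr C" "Dom C (Plus C f g) = Dom C f" "Cod C (Plus C f g) = Cod C f"
proof -
  interpret V: vectorspace K "hom_space C (Dom C f) (Cod C f)" using hom_vs assms by blast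
  have "Plus C f g \<in> Hom C (Dom C f) (Cod C f)"
    using V.M.add.m_closed[of f g] assms by (simp add: Hom_def)
  then show "Plus C f g \<in> Arr C" "Dom C (Plus C f g) = Dom C f" "Cod C (Plus C f g) = Cod C f"
    by (auto simp: Hom_def)
qed

lemma Scale_arr:
  assumes "f \<in> Arr C" "a \<in> carrier K"
  shows "Scale C a f \<in> Arr C" "Dom C (Scale C a f) = Dom C f" "Cod C (Scale C a f) = Cod C f"
proof -
  interpret V: vectorspace K "hom_space C (Dom C f) (Cod C f)" using hom_vs assms by blast
  have "Scale C a f \<in> Hom C (Dom C f) (Cod C f)"
    using V.smult_closed[of a f] assms by (simp add: Hom_def)
  then show "Scale C a f \<in> Arr C" "Dom C (Scale C a f) = Dom C f" "Cod C (Scale C a f) = Cod C f"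
    by (auto simp: Hom_def)
qed

lemma Neg_arr:
  assumes "f \<in> Arr C"
  shows "Neg f \<in> Arr C" "Dom C (Neg f) = Dom C f" "Cod C (Neg f) = Cod C f"
  unfolding Neg_def using Scale_arr[OF assms minus_one] by auto

lemma Neg_eq:
  assumes "f \<in> Hom C A B" shows "Neg f = \<ominus>\<^bsub>hom_space C A B\<^esub> f"
proof -
  interpret V: vectorspace K "hom_space C A B" using Hom_vectorspace Hom_Obj[OF assms] by blast
  show ?thesis
    using V.smult_l_minus[of "\<one>\<^bsub>K\<^esub>" f] V.smult_one[of f] assms by (simp add: Neg_def)
qed

lemma Comp_ident_arr:
  "f \<in> Arr C \<Longrightarrow> Dom C f = A \<Longrightarrow> Comp C f (Ident C A) = f"
  "f \<in> Arr C \<Longrightarrow> Cod C f = A \<Longrightarrow> Comp C (Ident C A) f = f"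
  using Comp_Ident Ident_Comp by (auto simp: Hom_def)

lemma Comp_assoc_arr:
  "f \<in> Arr C \<Longrightarrow> g \<in> Arr C \<Longrightarrow> h \<in> Arr C \<Longrightarrow> Dom C g = Cod C f \<Longrightarrow> Dom C h = Cod C g \<Longrightarrow>
    Comp C (Comp C h g) f = Comp C h (Comp C g f)"
  using Comp_assoc[of f "Dom C f" "Cod C f" g "Cod C g" h "Cod C h"] by (simp add: Hom_def)

lemma Comp_Plus_arr:
  "f \<in> Arr C \<Longrightarrow> f' \<in> Arr C \<Longrightarrow> g \<in> Arr C \<Longrightarrow> Dom C f' = Dom C f \<Longrightarrow> Cod C f' = Cod C f \<Longrightarrow>
    Dom C g = Cod C f \<Longrightarrow> Comp C g (Plus C f f') = Plus C (Comp C g f) (Comp C g f')"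
  "f \<in> Arr C \<Longrightarrow> g \<in> Arr C \<Longrightarrow> g' \<in> Arr C \<Longrightarrow> Dom C g' = Dom C g \<Longrightarrow> Cod C g' = Cod C g \<Longrightarrow>
    Dom C g = Cod C f \<Longrightarrow> Comp C (Plus C g g') f = Plus C (Comp C g f) (Comp C g' f)"
  using Comp_Plus_right[of f "Dom C f" "Cod C f" f' g "Cod C g"]
    Comp_Plus_left[of f "Dom C f" "Cod C f" g "Cod C g" g'] by (simp_all add: Hom_def)

lemma Comp_Scale_arr:
  "f \<in> Arr C \<Longrightarrow> g \<in> Arr C \<Longrightarrow> Dom C g = Cod C f \<Longrightarrow> a \<in> carrier K \<Longrightarrow>
    Comp C g (Scale C a f) = Scale C a (Comp C g f)"
  "f \<in> Arr C \<Longrightarrow> g \<in> Arr C \<Longrightarrow> Dom C g = Cod C f \<Longrightarrow> a \<in> carrier K \<Longrightarrow>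
    Comp C (Scale C a g) f = Scale C a (Comp C g f)"
  using Comp_Scale_right[of f "Dom C f" "Cod C f" g "Cod C g" a]
    Comp_Scale_left[of f "Dom C f" "Cod C f" g "Cod C g" a] by (simp_all add: Hom_def)

lemma Comp_Neg_arr:
  "f \<in> Arr C \<Longrightarrow> g \<in> Arr C \<Longrightarrow> Dom C g = Cod C f \<Longrightarrow> Comp C g (Neg f) = Neg (Comp C g f)"
  "f \<in> Arr C \<Longrightarrow> g \<in> Arr C \<Longrightarrow> Dom C g = Cod C f \<Longrightarrow> Comp C (Neg g) f = Neg (Comp C g f)"
  unfolding Neg_def using Comp_Scale_arr minus_one by auto

lemma Scale_Zero:
  assumes "a \<in> carrier K" "A \<in> Obj C" "B \<in> Obj C" shows "Scale C a (Zero C A B) = Zero C A B"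
proof -
  interpret V: vectorspace K "hom_space C A B" using Hom_vectorspace assms by blast
  show ?thesis using V.smult_r_null[of a] assms by simp
qed

lemma Scale_null:
  assumes "f \<in> Arr C" shows "Scale C \<zero>\<^bsub>K\<^esub> f = Zero C (Dom C f) (Cod C f)"
proof -
  interpret V: vectorspace K "hom_space C (Dom C f) (Cod C f)" using hom_vs assms by blast
  show ?thesis using V.smult_l_null[of f] assms by (simp add: Hom_def)
qed

lemma Comp_Zero_arr:
  assumes "f \<in> Arr C"
  shows "A \<in> Obj C \<Longrightarrow> Dom C f = B \<Longrightarrow> Comp C f (Zero C A B) = Zero C A (Cod C f)"
    "B \<in> Obj C \<Longrightarrow> Cod C f = A \<Longrightarrow> Comp C (Zero C A B) f = Zero C (Dom C f) B"
proof -
  interpret K: field K by (rule field)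
  assume A: "A \<in> Obj C" and B: "Dom C f = B"
  note B' = Dom_in[OF assms] Cod_in[OF assms]
  have "Zero C A B = Scale C \<zero>\<^bsub>K\<^esub> (Zero C A B)" using Scale_Zero A B B' by simp
  then have "Comp C f (Zero C A B) = Scale C \<zero>\<^bsub>K\<^esub> (Comp C f (Zero C A B))"
    using Comp_Scale_arr(1)[of "Zero C A B" f "\<zero>\<^bsub>K\<^esub>"] assms A B B' by (simp add: Zero_arr)
  then show "Comp C f (Zero C A B) = Zero C A (Cod C f)"
    using Scale_null[of "Comp C f (Zero C A B)"] assms A B B' by (simp add: Zero_arr Comp_arr)
next
  interpret K: field K by (rule field)
  assume A: "B \<in> Obj C" and B: "Cod C f = A"
  note B' = Dom_in[OF assms] Cod_in[OF assms]
  have "Zero C A B = Scale C \<zero>\<^bsub>K\<^esub> (Zero C A B)" using Scale_Zero A B B' by simp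
  then have "Comp C (Zero C A B) f = Scale C \<zero>\<^bsub>K\<^esub> (Comp C (Zero C A B) f)"
    using Comp_Scale_arr(2)[of f "Zero C A B" "\<zero>\<^bsub>K\<^esub>"] assms A B B' by (simp add: Zero_arr)
  then show "Comp C (Zero C A B) f = Zero C (Dom C f) B"
    using Scale_null[of "Comp C (Zero C A B) f"] assms A B B' by (simp add: Zero_arr Comp_arr)
qed

lemma Plus_ac:
  assumes "f \<in> Arr C" "g \<in> Arr C" "Dom C g = Dom C f" "Cod C g = Cod C f"
  shows "Plus C f g = Plus C g f"
    "h \<in> Arr C \<Longrightarrow> Dom C h = Dom C f \<Longrightarrow> Cod C h = Cod C f \<Longrightarrow>
      Plus C (Plus C f g) h = Plus C f (Plus C g h)"
    "h \<in> Arr C \<Longrightarrow> Dom C h = Dom C f \<Longrightarrow> Cod C h = Cod C f \<Longrightarrow>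
      Plus C f (Plus C g h) = Plus C g (Plus C f h)"
proof -
  interpret V: vectorspace K "hom_space C (Dom C f) (Cod C f)" using hom_vs assms by blast
  show "Plus C f g = Plus C g f" using V.M.add.m_comm[of f g] assms by (simp add: Hom_def)
  assume "h \<in> Arr C" "Dom C h = Dom C f" "Cod C h = Cod C f"
  then show "Plus C (Plus C f g) h = Plus C f (Plus C g h)"
    "Plus C f (Plus C g h) = Plus C g (Plus C f h)"
    using V.M.add.m_assoc[of f g h] V.M.add.m_lcomm[of f g h] assms by (simp_all add: Hom_def)
qed

lemma Plus_Zero:
  assumes "f \<in> Arr C" "Dom C f = A" "Cod C f = B"
  shows "Plus C f (Zero C A B) = f" "Plus C (Zero C A B) f = f"
proof -
  interpret V: vectorspace K "hom_space C (Dom C f) (Cod C f)" using hom_vs assms by blast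
  show "Plus C f (Zero C A B) = f" "Plus C (Zero C A B) f = f"
    using V.M.r_zero[of f] V.M.l_zero[of f] assms by (simp_all add: Hom_def)
qed

lemma Plus_Neg:
  assumes "f \<in> Arr C"
  shows "Plus C f (Neg f) = Zero C (Dom C f) (Cod C f)"
    "Plus C (Neg f) f = Zero C (Dom C f) (Cod C f)"
    "g \<in> Arr C \<Longrightarrow> Dom C g = Dom C f \<Longrightarrow> Cod C g = Cod C f \<Longrightarrow> Plus C f (Plus C (Neg f) g) = g"
    "g \<in> Arr C \<Longrightarrow> Dom C g = Dom C f \<Longrightarrow> Cod C g = Cod C f \<Longrightarrow> Plus C (Neg f) (Plus C f g) = g"
proof -
  interpret V: vectorspace K "hom_space C (Dom C f) (Cod C f)" using hom_vs assms by blast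
  have f: "f \<in> Hom C (Dom C f) (Cod C f)" using assms by (simp add: Hom_def)
  show 1: "Plus C f (Neg f) = Zero C (Dom C f) (Cod C f)"
    "Plus C (Neg f) f = Zero C (Dom C f) (Cod C f)"
    using V.M.r_neg[of f] V.M.l_neg[of f] f by (simp_all add: Neg_eq[OF f])
  assume g: "g \<in> Arr C" "Dom C g = Dom C f" "Cod C g = Cod C f"
  show "Plus C f (Plus C (Neg f) g) = g" "Plus C (Neg f) (Plus C f g) = g"
    using assms g 1 by (simp_all add: Plus_ac(2)[symmetric] Neg_arr Plus_Zero)
qed

lemma Neg_Zero:
  assumes "A \<in> Obj C" "B \<in> Obj C" shows "Neg (Zero C A B) = Zero C A B"
  using Scale_Zero[OF minus_one assms] by (simp add: Neg_def)

lemma Neg_Neg: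
  assumes "f \<in> Arr C" shows "Neg (Neg f) = f"
proof -
  have "Plus C f (Plus C (Neg f) (Neg (Neg f))) = Neg (Neg f)"
    using assms by (intro Plus_Neg(3)) (simp_all add: Neg_arr)
  then show ?thesis using assms by (simp add: Plus_Neg(1) Neg_arr Plus_Zero)
qed

lemma Neg_Plus:
  assumes "f \<in> Arr C" "g \<in> Arr C" "Dom C g = Dom C f" "Cod C g = Cod C f"
  shows "Neg (Plus C f g) = Plus C (Neg f) (Neg g)"
proof -
  interpret V: vectorspace K "hom_space C (Dom C f) (Cod C f)" using hom_vs assms by blast
  show ?thesis
    using V.smult_r_distr[of "\<ominus>\<^bsub>K\<^esub> \<one>\<^bsub>K\<^esub>" f g] assms minus_one by (simp add: Hom_def Neg_def)
qed

lemmas arr_simps = Dom_in Cod_in Ident_arr Comp_arr Zero_arr Plus_arr Neg_arr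

lemmas lin_simps = arr_simps Comp_ident_arr Comp_assoc_arr Comp_Plus_arr Comp_Neg_arr
  Comp_Zero_arr Plus_ac Plus_Zero Plus_Neg Neg_Zero Neg_Neg Neg_Plus

lemma diff_eq_Zero:
  assumes "f \<in> Arr C" "g \<in> Arr C" "Dom C g = Dom C f" "Cod C g = Cod C f"
    and "Plus C f (Neg g) = Zero C (Dom C f) (Cod C f)"
  shows "f = g"
proof -
  have "f = Plus C (Plus C f (Neg g)) g"
    using assms(1-4) by (simp add: Plus_ac(2) Plus_Neg Plus_Zero Neg_arr)
  also have "\<dots> = g" unfolding assms(5) using assms(1-4) by (simp add: Plus_Zero)
  finally show ?thesis .
qed

lemma Zero_Hom: "A \<in> Obj C \<Longrightarrow> B \<in> Obj C \<Longrightarrow> Zero C A B \<in> Hom C A B"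
  by (simp add: Hom_def Zero_arr)

lemma zero_object_unique:
  assumes "zero_object C A" "f \<in> Hom C A B"
  shows "f = Zero C A B"
  using assms Hom_Obj[OF assms(2)] Zero_Hom unfolding zero_object_def by metis

lemma zero_object_unique':
  assumes "zero_object C A" "f \<in> Hom C B A"
  shows "f = Zero C B A"
  using assms Hom_Obj[OF assms(2)] Zero_Hom unfolding zero_object_def by metis

lemma zero_object_iff:
  assumes A: "A \<in> Obj C"
  shows "zero_object C A \<longleftrightarrow> Ident C A = Zero C A A"
proof
  assume "zero_object C A"
  then show "Ident C A = Zero C A A" using zero_object_unique Ident_in A by blast
next
  assume 0: "Ident C A = Zero C A A"
  have "f = Zero C A B" if f: "f \<in> Hom C A B" for f B
  proof -
    have "f = Comp C f (Zero C A A)" using Comp_Ident[OF f] 0 by simp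
    then show ?thesis using f A by (simp add: Hom_def Comp_Zero_arr)
  qed
  moreover have "f = Zero C B A" if f: "f \<in> Hom C B A" for f B
  proof -
    have "f = Comp C (Zero C A A) f" using Ident_Comp[OF f] 0 by simp
    then show ?thesis using f A by (simp add: Hom_def Comp_Zero_arr)
  qed
  ultimately show "zero_object C A"
    using A Zero_Hom unfolding zero_object_def by metis
qed

end

section \<open>Regular arrows and semisimple categories\<close>

text \<open>
  The part of \<^const>\<open>direct_sum\<close> that is used below: the inclusions \<open>\<iota>\<close> and projections \<open>\<pi>\<close> are typed
  correctly and decompose the identity. Orthogonality is not needed.
\<close>

definition is_biproduct ::
    "('o, 'm, 'k) lincat \<Rightarrow> 'o \<Rightarrow> 'o list \<Rightarrow> (nat \<Rightarrow> 'm) \<Rightarrow> (nat \<Rightarrow> 'm) \<Rightarrow> bool" where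
  "is_biproduct C A Bs \<iota> \<pi> \<longleftrightarrow>
    (\<forall>k < length Bs. \<iota> k \<in> Hom C (Bs ! k) A \<and> \<pi> k \<in> Hom C A (Bs ! k)) \<and>
    finsum (hom_space C A A) (\<lambda>k. Comp C (\<iota> k) (\<pi> k)) {..<length Bs} = Ident C A"

lemma direct_sum_is_biproduct:
  assumes "direct_sum C A Bs"
  obtains \<iota> \<pi> where "is_biproduct C A Bs \<iota> \<pi>"
  using assms unfolding direct_sum_def is_biproduct_def by blast

context linear_category
begin

text \<open>
  Von Neumann regularity of an arrow. It is a first-order property, hence inherited by ultraproducts,
  and its witness lies in a Hom space, hence it is inherited by full subcategories.
\<close>

definition regular_arr :: "'m \<Rightarrow> bool" where
  "regular_arr f \<longleftrightarrow> (\<exists>g \<in> Hom C (Cod C f) (Dom C f). Comp C f (Comp C g f) = f)"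

text \<open>
  McCoy's lemma: \<open>f\<close> is regular as soon as \<open>f - f g f\<close> is regular for some \<open>g\<close>.
\<close>

lemma regular_residue:
  assumes f: "f \<in> Hom C A B" and g: "g \<in> Hom C B A"
    and reg: "regular_arr (Plus C f (Neg (Comp C f (Comp C g f))))"
  shows "regular_arr f"
proof -
  let ?r = "Plus C f (Neg (Comp C f (Comp C g f)))"
  have fs: "f \<in> Arr C" "Dom C f = A" "Cod C f = B" and gs: "g \<in> Arr C" "Dom C g = B" "Cod C g = A"
    using f g by (auto simp: Hom_def)
  note obj = Hom_Obj[OF f]
  have "Dom C ?r = A" "Cod C ?r = B" using fs gs by (simp_all add: arr_simps)
  then obtain y where y: "y \<in> Arr C" "Dom C y = B" "Cod C y = A" "Comp C ?r (Comp C y ?r) = ?r"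
    using reg unfolding regular_arr_def by (auto simp: Hom_def)
  \<comment> \<open>\<open>w = g + (1 - g f) y (1 - f g)\<close>, so that \<open>f w f = f g f + r y r\<close> with \<open>r = f - f g f\<close>\<close>
  let ?w = "Plus C g (Comp C (Plus C (Ident C A) (Neg (Comp C g f)))
    (Comp C y (Plus C (Ident C B) (Neg (Comp C f g)))))"
  have "?w \<in> Hom C B A" using fs gs y(1-3) obj by (intro HomI) (simp_all add: arr_simps)
  moreover have "Comp C f (Comp C ?w f) = Plus C (Comp C f (Comp C g f)) (Comp C ?r (Comp C y ?r))"
    using fs gs y(1-3) obj by (simp add: lin_simps)
  then have "Comp C f (Comp C ?w f) = f"
    unfolding y(4) using fs gs by (simp add: lin_simps)
  ultimately show ?thesis using fs unfolding regular_arr_def by blast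
qed

text \<open>
  A property closed under sums holds for \<open>f\<close> if it holds for the components of \<open>f\<close> with respect
  to a decomposition of its domain, or (in the lemma after it) of its codomain.
\<close>

lemma biproduct_induct_right:
  assumes bp: "is_biproduct C A Bs \<iota> \<pi>" and f: "f \<in> Hom C A Y"
    and zero: "P (Zero C A Y)"
    and plus: "\<And>u v. u \<in> Hom C A Y \<Longrightarrow> v \<in> Hom C A Y \<Longrightarrow> P u \<Longrightarrow> P v \<Longrightarrow> P (Plus C u v)"
    and comp: "\<And>k. k < length Bs \<Longrightarrow> P (Comp C f (Comp C (\<iota> k) (\<pi> k)))"
  shows "P f"
proof -
  let ?e = "\<lambda>k. Comp C (\<iota> k) (\<pi> k)"
  note obj = Hom_Obj[OF f]
  interpret V: vectorspace K "hom_space C A A" using Hom_vectorspace obj by blast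
  have fs: "f \<in> Arr C" "Dom C f = A" "Cod C f = Y" using f by (auto simp: Hom_def)
  have e: "?e k \<in> Hom C A A" if "k < length Bs" for k
    using bp that Comp_in unfolding is_biproduct_def by blast
  have "finsum (hom_space C A A) ?e I \<in> Hom C A A \<and> P (Comp C f (finsum (hom_space C A A) ?e I))"
    if "finite I" "I \<subseteq> {..<length Bs}" for I
    using that
  proof (induction I)
    case empty
    then show ?case using zero fs obj by (simp add: Comp_Zero_arr Zero_Hom)
  next
    case (insert k I)
    let ?s = "finsum (hom_space C A A) ?e I"
    have s: "?s \<in> Hom C A A" "P (Comp C f ?s)" using insert by auto
    have k: "?e k \<in> Hom C A A" "P (Comp C f (?e k))" using insert.prems e comp by auto
    have fin: "finsum (hom_space C A A) ?e (insert k I) = Plus C (?e k) ?s"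
      using V.M.finsum_insert[of I k ?e] insert e by (auto simp: subset_iff)
    have "Plus C (?e k) ?s \<in> Hom C A A"
      using s(1) k(1) by (simp add: Hom_def Plus_arr)
    moreover have "P (Plus C (Comp C f (?e k)) (Comp C f ?s))"
      by (rule plus[OF Comp_in[OF k(1) f] Comp_in[OF s(1) f] k(2) s(2)])
    ultimately show ?case unfolding fin Comp_Plus_right[OF k(1) s(1) f] by blast
  qed
  from this[of "{..<length Bs}"] show ?thesis
    using bp Comp_Ident[OF f] unfolding is_biproduct_def by simp
qed

lemma biproduct_induct_left:
  assumes bp: "is_biproduct C A Bs \<iota> \<pi>" and f: "f \<in> Hom C Y A"
    and zero: "P (Zero C Y A)"
    and plus: "\<And>u v. u \<in> Hom C Y A \<Longrightarrow> v \<in> Hom C Y A \<Longrightarrow> P u \<Longrightarrow> P v \<Longrightarrow> P (Plus C u v)"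
    and comp: "\<And>k. k < length Bs \<Longrightarrow> P (Comp C (Comp C (\<iota> k) (\<pi> k)) f)"
  shows "P f"
proof -
  let ?e = "\<lambda>k. Comp C (\<iota> k) (\<pi> k)"
  note obj = Hom_Obj[OF f]
  interpret V: vectorspace K "hom_space C A A" using Hom_vectorspace obj by blast
  have fs: "f \<in> Arr C" "Dom C f = Y" "Cod C f = A" using f by (auto simp: Hom_def)
  have e: "?e k \<in> Hom C A A" if "k < length Bs" for k
    using bp that Comp_in unfolding is_biproduct_def by blast
  have "finsum (hom_space C A A) ?e I \<in> Hom C A A \<and> P (Comp C (finsum (hom_space C A A) ?e I) f)"
    if "finite I" "I \<subseteq> {..<length Bs}" for I
    using that
  proof (induction I)
    case empty
    then show ?case using zero fs obj by (simp add: Comp_Zero_arr Zero_Hom)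
  next
    case (insert k I)
    let ?s = "finsum (hom_space C A A) ?e I"
    have s: "?s \<in> Hom C A A" "P (Comp C ?s f)" using insert by auto
    have k: "?e k \<in> Hom C A A" "P (Comp C (?e k) f)" using insert.prems e comp by auto
    have fin: "finsum (hom_space C A A) ?e (insert k I) = Plus C (?e k) ?s"
      using V.M.finsum_insert[of I k ?e] insert e by (auto simp: subset_iff)
    have "Plus C (?e k) ?s \<in> Hom C A A"
      using s(1) k(1) by (simp add: Hom_def Plus_arr)
    moreover have "P (Plus C (Comp C (?e k) f) (Comp C ?s f))"
      by (rule plus[OF Comp_in[OF f k(1)] Comp_in[OF f s(1)] k(2) s(2)])
    ultimately show ?case unfolding fin Comp_Plus_left[OF f k(1) s(1)] by blast
  qed
  from this[of "{..<length Bs}"] show ?thesis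
    using bp Ident_Comp[OF f] unfolding is_biproduct_def by simp
qed

lemma kernel_mono:
  assumes k: "kernel_of C f k"
  shows "mono_arr C k"
  unfolding mono_arr_def
proof (intro conjI ballI impI)
  show "k \<in> Arr C" using k unfolding kernel_of_def by blast
next
  fix W g h
  assume W: "W \<in> Obj C" and g: "g \<in> Hom C W (Dom C k)" and h: "h \<in> Hom C W (Dom C k)"
    and eq: "Comp C k g = Comp C k h"
  have ks: "f \<in> Arr C" "k \<in> Arr C" "Cod C k = Dom C f"
      "Comp C f k = Zero C (Dom C k) (Cod C f)"
    and univ: "\<And>W h. W \<in> Obj C \<Longrightarrow> h \<in> Hom C W (Dom C f) \<Longrightarrow> Comp C f h = Zero C W (Cod C f) \<Longrightarrow>
      \<exists>!u. u \<in> Hom C W (Dom C k) \<and> Comp C k u = h"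
    using k unfolding kernel_of_def by blast+
  have gs: "g \<in> Arr C" "Dom C g = W" "Cod C g = Dom C k" using g by (auto simp: Hom_def)
  have "Comp C f (Comp C k g) = Comp C (Comp C f k) g"
    using ks(1-3) gs by (simp add: Comp_assoc_arr)
  also have "\<dots> = Zero C W (Cod C f)"
    unfolding ks(4) using gs ks(1-3) by (simp add: lin_simps)
  finally have "Comp C f (Comp C k g) = Zero C W (Cod C f)" .
  moreover have "Comp C k g \<in> Hom C W (Dom C f)" using gs ks by (intro HomI) (simp_all add: arr_simps)
  ultimately show "g = h" using univ[OF W, of "Comp C k g"] g h eq by auto
qed

lemma simple_nonzero_invertible:
  assumes kernels: "\<And>f. f \<in> Arr C \<Longrightarrow> \<exists>k. kernel_of C f k"
    and S: "simple_object C S" and T: "simple_object C T"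
    and f: "f \<in> Hom C S T" and nz: "f \<noteq> Zero C S T"
  shows "\<exists>g \<in> Hom C T S. Comp C g f = Ident C S \<and> Comp C f g = Ident C T"
proof -
  have fs: "f \<in> Arr C" "Dom C f = S" "Cod C f = T" using f by (auto simp: Hom_def)
  note obj = Hom_Obj[OF f]
  obtain k where k: "kernel_of C f k" using kernels fs(1) by blast
  have ks: "k \<in> Arr C" "Cod C k = S" "Comp C f k = Zero C (Dom C k) T"
    and univ: "\<And>W h. W \<in> Obj C \<Longrightarrow> h \<in> Hom C W S \<Longrightarrow> Comp C f h = Zero C W T \<Longrightarrow>
      \<exists>!u. u \<in> Hom C W (Dom C k) \<and> Comp C k u = h"
    using k fs unfolding kernel_of_def by auto
  have "zero_object C (Dom C k) \<or> iso_arr C k"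
    using S kernel_mono[OF k] ks(2) unfolding simple_object_def by blast
  moreover have "\<not> iso_arr C k"
  proof
    assume "iso_arr C k"
    then obtain g where g: "g \<in> Hom C S (Dom C k)" "Comp C k g = Ident C S"
      using ks(2) unfolding iso_arr_def by auto
    have gs: "g \<in> Arr C" "Dom C g = S" "Cod C g = Dom C k" using g by (auto simp: Hom_def)
    have "f = Comp C (Comp C f k) g"
      using fs ks(1,2) gs g(2) by (simp add: lin_simps)
    also have "\<dots> = Zero C S T" unfolding ks(3) using gs obj by (simp add: lin_simps)
    finally show False using nz by simp
  qed
  ultimately have zero: "zero_object C (Dom C k)" by blast
  have "mono_arr C f"
    unfolding mono_arr_def
  proof (intro conjI ballI impI)
    fix W g h
    assume W: "W \<in> Obj C" and g: "g \<in> Hom C W (Dom C f)" and h: "h \<in> Hom C W (Dom C f)"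
      and eq: "Comp C f g = Comp C f h"
    have gs: "g \<in> Arr C" "Dom C g = W" "Cod C g = S" and hs: "h \<in> Arr C" "Dom C h = W" "Cod C h = S"
      using g h fs by (auto simp: Hom_def)
    let ?d = "Plus C g (Neg h)"
    have d: "?d \<in> Hom C W S" using gs hs by (intro HomI) (simp_all add: arr_simps)
    have "Comp C f ?d = Zero C W T" using gs hs fs eq by (simp add: lin_simps)
    then obtain u where u: "u \<in> Hom C W (Dom C k)" "Comp C k u = ?d"
      using univ[OF W d] by blast
    have "u = Zero C W (Dom C k)" by (rule zero_object_unique'[OF zero u(1)])
    then have "?d = Zero C W S" using u(2) ks(1,2) W by (simp add: lin_simps)
    then show "g = h" using diff_eq_Zero[of g h] gs hs by simp
  qed (use fs in simp)
  then have "zero_object C S \<or> iso_arr C f" using T fs unfolding simple_object_def by blast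
  then have "iso_arr C f" using S unfolding simple_object_def by blast
  then show ?thesis using fs unfolding iso_arr_def by auto
qed

text \<open>
  View \<open>f\<close> as a matrix with respect to decompositions into simple objects. A nonzero entry is
  invertible; subtracting \<open>f g f\<close>, with \<open>g\<close> built from the inverse of that entry, clears the row of the
  entry and keeps the zero rows. Induction on the number of nonzero rows (Gaussian elimination)
  and \<open>regular_residue\<close> give regularity.
\<close>

lemma semisimple_regular:
  assumes kernels: "\<And>f. f \<in> Arr C \<Longrightarrow> \<exists>k. kernel_of C f k"
    and sums: "\<And>A. A \<in> Obj C \<Longrightarrow> \<exists>Ss. (\<forall>S \<in> set Ss. simple_object C S) \<and> direct_sum C A Ss"
    and f: "f \<in> Hom C A B"
  shows "regular_arr f"
proof -
  note obj = Hom_Obj[OF f]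
  obtain Ss \<iota> \<pi> where Ss: "\<And>S. S \<in> set Ss \<Longrightarrow> simple_object C S" and bp: "is_biproduct C A Ss \<iota> \<pi>"
    using sums[OF obj(1)] direct_sum_is_biproduct by metis
  obtain Ts \<iota>' \<pi>' where Ts: "\<And>S. S \<in> set Ts \<Longrightarrow> simple_object C S" and bp': "is_biproduct C B Ts \<iota>' \<pi>'"
    using sums[OF obj(2)] direct_sum_is_biproduct by metis
  have i: "\<iota> k \<in> Arr C" "Dom C (\<iota> k) = Ss ! k" "Cod C (\<iota> k) = A"
      "\<pi> k \<in> Arr C" "Dom C (\<pi> k) = A" "Cod C (\<pi> k) = Ss ! k" if "k < length Ss" for k
    using bp that unfolding is_biproduct_def Hom_def by auto
  have i': "\<iota>' k \<in> Arr C" "Dom C (\<iota>' k) = Ts ! k" "Cod C (\<iota>' k) = B"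
      "\<pi>' k \<in> Arr C" "Dom C (\<pi>' k) = B" "Cod C (\<pi>' k) = Ts ! k" if "k < length Ts" for k
    using bp' that unfolding is_biproduct_def Hom_def by auto
  let ?R = "\<lambda>f. {l. l < length Ts \<and> Comp C (\<pi>' l) f \<noteq> Zero C A (Ts ! l)}"
  show ?thesis
    using f
  proof (induction "card (?R f)" arbitrary: f rule: less_induct)
    case less
    note f = less.prems
    have fs: "f \<in> Arr C" "Dom C f = A" "Cod C f = B" using f by (auto simp: Hom_def)
    show ?case
    proof (cases "?R f = {}")
      case True
      have "f = Zero C A B"
      proof (rule biproduct_induct_left[OF bp' f])
        fix l assume l: "l < length Ts"
        have "Comp C (Comp C (\<iota>' l) (\<pi>' l)) f = Comp C (\<iota>' l) (Comp C (\<pi>' l) f)"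
          using i'[OF l] fs by (simp add: Comp_assoc_arr)
        also have "Comp C (\<pi>' l) f = Zero C A (Ts ! l)" using True l by blast
        finally show "Comp C (Comp C (\<iota>' l) (\<pi>' l)) f = Zero C A B"
          using i'[OF l] obj by (simp add: lin_simps)
      qed (use obj in \<open>simp_all add: lin_simps\<close>)
      then have "Comp C f (Comp C (Zero C B A) f) = f" using obj by (simp add: lin_simps)
      then show ?thesis unfolding regular_arr_def using Zero_Hom obj fs by blast
    next
      case False
      then obtain l where l: "l < length Ts" "Comp C (\<pi>' l) f \<noteq> Zero C A (Ts ! l)" by blast
      let ?p = "Comp C (\<pi>' l) f"
      have p: "?p \<in> Hom C A (Ts ! l)" using i'[OF l(1)] fs by (intro HomI) (simp_all add: arr_simps)
      have Tl: "Ts ! l \<in> Obj C" using Hom_Obj p by blast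
      have "\<exists>k < length Ss. Comp C ?p (\<iota> k) \<noteq> Zero C (Ss ! k) (Ts ! l)"
      proof (rule ccontr)
        assume neg: "\<not> ?thesis"
        have "?p = Zero C A (Ts ! l)"
        proof (rule biproduct_induct_right[OF bp p])
          fix k assume k: "k < length Ss"
          have "Comp C ?p (Comp C (\<iota> k) (\<pi> k)) = Comp C (Comp C ?p (\<iota> k)) (\<pi> k)"
            using i[OF k] i'[OF l(1)] fs by (simp add: Comp_arr Comp_assoc_arr)
          also have "Comp C ?p (\<iota> k) = Zero C (Ss ! k) (Ts ! l)" using neg k by blast
          finally show "Comp C ?p (Comp C (\<iota> k) (\<pi> k)) = Zero C A (Ts ! l)"
            using i[OF k] Tl by (simp add: lin_simps)
        qed (use obj Tl in \<open>simp_all add: lin_simps\<close>)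
        then show False using l(2) by simp
      qed
      then obtain k where k: "k < length Ss" "Comp C ?p (\<iota> k) \<noteq> Zero C (Ss ! k) (Ts ! l)" by blast
      have "Comp C ?p (\<iota> k) \<in> Hom C (Ss ! k) (Ts ! l)"
        using i[OF k(1)] i'[OF l(1)] fs by (intro HomI) (simp_all add: arr_simps)
      then obtain h where h: "h \<in> Hom C (Ts ! l) (Ss ! k)"
          "Comp C (Comp C ?p (\<iota> k)) h = Ident C (Ts ! l)"
        using simple_nonzero_invertible[OF kernels Ss Ts] k l(1) by (metis nth_mem)
      have hs: "h \<in> Arr C" "Dom C h = Ts ! l" "Cod C h = Ss ! k" using h(1) by (auto simp: Hom_def)
      let ?g = "Comp C (\<iota> k) (Comp C h (\<pi>' l))"
      let ?r = "Plus C f (Neg (Comp C f (Comp C ?g f)))"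
      note simps = i[OF k(1)] i'[OF l(1)] fs hs
      have g: "?g \<in> Hom C B A" using simps by (intro HomI) (simp_all add: arr_simps)
      have r: "?r \<in> Hom C A B" using simps by (intro HomI) (simp_all add: arr_simps)
      have row: "Comp C (\<pi>' l) ?r = Zero C A (Ts ! l)"
      proof -
        have "Comp C (\<pi>' l) ?r = Plus C ?p (Neg (Comp C (Comp C (Comp C ?p (\<iota> k)) h) ?p))"
          using simps by (simp add: lin_simps)
        also have "\<dots> = Zero C A (Ts ! l)" unfolding h(2) using simps Tl by (simp add: lin_simps)
        finally show ?thesis .
      qed
      have rows: "Comp C (\<pi>' j) ?r = Zero C A (Ts ! j)"
        if j: "j < length Ts" "Comp C (\<pi>' j) f = Zero C A (Ts ! j)" for j
      proof -
        have Tj: "Ts ! j \<in> Obj C" using i'(6)[OF j(1)] i'(4)[OF j(1)] Cod_in by metis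
        have "Comp C (\<pi>' j) ?r = Plus C (Comp C (\<pi>' j) f) (Neg (Comp C (Comp C (\<pi>' j) f) (Comp C ?g f)))"
          using simps i'[OF j(1)] by (simp add: lin_simps)
        also have "\<dots> = Zero C A (Ts ! j)" unfolding j(2) using simps Tj obj by (simp add: lin_simps)
        finally show ?thesis .
      qed
      have "?R ?r \<subset> ?R f" using row rows l by blast
      then have "card (?R ?r) < card (?R f)" by (intro psubset_card_mono) simp_all
      then have "regular_arr ?r" using less.hyps r by blast
      then show ?thesis by (rule regular_residue[OF f g])
    qed
  qed
qed

end

section \<open>Consequences of regularity\<close>

text \<open>
  In a local ring the only idempotents are \<open>0\<close> and \<open>1\<close>. Applied to \<open>x y\<close> and \<open>y x\<close>, this shows that a
  nonzero regular element \<open>x\<close> is a unit.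
\<close>

lemma (in ring) local_regular_unit:
  assumes loc: "local_ring R" and x: "x \<in> carrier R" and y: "y \<in> carrier R"
    and reg: "x \<otimes> (y \<otimes> x) = x"
  shows "x = \<zero> \<or> x \<in> Units R"
proof -
  let ?N = "carrier R - Units R"
  interpret N: ideal ?N R using loc unfolding local_ring_def by blast
  have idem: "e = \<zero> \<or> e = \<one>" if e: "e \<in> carrier R" "e \<otimes> e = e" for e
  proof (cases "e \<in> Units R")
    case True
    have "e = inv e \<otimes> (e \<otimes> e)" using True e(1) by (simp add: m_assoc[symmetric])
    then show ?thesis using True e(2) by simp
  next
    case False
    let ?f = "\<one> \<ominus> e"
    have f: "?f \<in> carrier R" using e(1) by simp
    have ef: "e \<otimes> ?f = \<zero>" using e by (simp add: a_minus_def r_distr r_minus r_neg)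
    have "?f \<in> Units R"
    proof (rule ccontr)
      assume "?f \<notin> Units R"
      then have "e \<oplus> ?f \<in> ?N" 
        using additive_subgroup.a_closed[OF N.is_additive_subgroup] False e(1) f by blast
      moreover have "e \<oplus> ?f = \<one>" using e(1) by (simp add: a_minus_def a_lcomm[of e] r_neg)
      ultimately show False by simp
    qed
    then have "e = (e \<otimes> ?f) \<otimes> inv ?f" using e(1) by (simp add: m_assoc)
    then show ?thesis using ef \<open>?f \<in> Units R\<close> by simp
  qed
  have xy: "(x \<otimes> y) \<otimes> (x \<otimes> y) = x \<otimes> y" and yx: "(y \<otimes> x) \<otimes> (y \<otimes> x) = y \<otimes> x"
    using x y reg by (metis m_assoc m_closed)+
  show ?thesis
  proof (cases "x = \<zero>")
    case False
    have "x \<otimes> y \<noteq> \<zero>" using False reg x y by (metis l_null m_assoc)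
    moreover have "y \<otimes> x \<noteq> \<zero>" using False reg x y by (metis r_null)
    ultimately have "x \<otimes> y = \<one>" "y \<otimes> x = \<one>"
      using idem[OF _ xy] idem[OF _ yx] x y by auto
    then show ?thesis using x y unfolding Units_def by blast
  qed simp
qed

context linear_category
begin

lemma End_ring:
  assumes A: "A \<in> Obj C"
  shows "ring (hom_space C A A)"
proof -
  interpret V: vectorspace K "hom_space C A A" using Hom_vectorspace A by blast
  show ?thesis
  proof (rule ringI)
    show "abelian_group (hom_space C A A)" by (rule V.M.abelian_group_axioms)
    show "Group.monoid (hom_space C A A)"
      by (rule monoidI) (auto simp: Ident_in[OF A] Comp_in Ident_Comp Comp_Ident Comp_assoc[symmetric])
  qed (auto simp: Comp_Plus_right Comp_Plus_left)
qed

lemma End_field_algebra: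
  assumes A: "A \<in> Obj C"
  shows "field_algebra K (hom_space C A A)"
proof -
  interpret V: vectorspace K "hom_space C A A" using Hom_vectorspace A by blast
  interpret R: ring "hom_space C A A" by (rule End_ring[OF A])
  show ?thesis by unfold_locales (auto simp: Comp_Scale_left Comp_Scale_right)
qed

lemma Schur:
  assumes S: "S \<in> Obj C" and alg_closed: "algebraically_closed K"
    and fd: "vectorspace.fin_dim K (hom_space C S S)"
    and nz: "Ident C S \<noteq> Zero C S S"
    and division: "\<And>x. x \<in> Hom C S S \<Longrightarrow> x \<noteq> Zero C S S \<Longrightarrow> \<exists>y \<in> Hom C S S. Comp C y x = Ident C S"
    and x: "x \<in> Hom C S S"
  shows "\<exists>a \<in> carrier K. x = Scale C a (Ident C S)"
proof -
  interpret F: field_algebra K "hom_space C S S" by (rule End_field_algebra[OF S])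
  have "u = Zero C S S \<or> v = Zero C S S"
    if u: "u \<in> Hom C S S" and v: "v \<in> Hom C S S" and 0: "Comp C u v = Zero C S S" for u v
  proof (cases "u = Zero C S S")
    case False
    then obtain y where y: "y \<in> Hom C S S" "Comp C y u = Ident C S" using division u by blast
    have "v = Comp C y (Comp C u v)" using y u v Comp_assoc[OF v u y(1)] Ident_Comp by simp
    also have "\<dots> = Zero C S S" unfolding 0 using y(1) S by (simp add: Comp_Zero_arr Hom_def)
    finally show ?thesis by simp
  qed simp
  then show ?thesis using F.scalar_if_no_zero_divisors[OF alg_closed fd] nz x by simp
qed

lemma regular_mono_split:
  assumes "mono_arr C f" "f \<in> Hom C A B" "g \<in> Hom C B A" "Comp C f (Comp C g f) = f"
  shows "Comp C g f = Ident C A"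
proof -
  have fs: "f \<in> Arr C" "Dom C f = A" "Cod C f = B" using assms(2) by (auto simp: Hom_def)
  have "Comp C f (Comp C g f) = Comp C f (Ident C A)"
    using assms(4) fs by (simp add: Comp_ident_arr)
  moreover have "Comp C g f \<in> Hom C A A" using Comp_in assms(2,3) by blast
  ultimately show ?thesis
    using assms(1) Ident_in Hom_Obj[OF assms(2)] fs unfolding mono_arr_def by blast
qed

text \<open>
  A monomorphism \<open>f\<close> into \<open>S\<close> is split by a quasi-inverse \<open>g\<close>, and \<open>f g\<close> is an idempotent endomorphism of
  \<open>S\<close>, hence zero or the identity.
\<close>

lemma simple_if_division:
  assumes reg: "\<And>f. f \<in> Arr C \<Longrightarrow> regular_arr f" and S: "S \<in> Obj C"
    and nz: "Ident C S \<noteq> Zero C S S"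
    and division: "\<And>x. x \<in> Hom C S S \<Longrightarrow> x \<noteq> Zero C S S \<Longrightarrow> \<exists>y \<in> Hom C S S. Comp C y x = Ident C S"
  shows "simple_object C S"
  unfolding simple_object_def
proof (intro conjI allI impI)
  show "S \<in> Obj C" by (rule S)
  show "\<not> zero_object C S" using zero_object_iff[OF S] nz by blast
next
  fix f assume "mono_arr C f \<and> Cod C f = S"
  then have mono: "mono_arr C f" and f: "f \<in> Hom C (Dom C f) S"
    unfolding mono_arr_def by (auto simp: Hom_def)
  let ?W = "Dom C f"
  have fs: "f \<in> Arr C" "Cod C f = S" using f by (auto simp: Hom_def)
  have W: "?W \<in> Obj C" using Hom_Obj f by blast
  obtain g where g: "g \<in> Hom C S ?W" "Comp C f (Comp C g f) = f"
    using reg[OF fs(1)] fs unfolding regular_arr_def by auto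
  have gs: "g \<in> Arr C" "Dom C g = S" "Cod C g = ?W" using g(1) by (auto simp: Hom_def)
  have gf: "Comp C g f = Ident C ?W" by (rule regular_mono_split[OF mono f g])
  let ?e = "Comp C f g"
  have e: "?e \<in> Hom C S S" using Comp_in g(1) f by blast
  have ee: "Comp C ?e ?e = ?e"
    using fs gs g(2) by (simp add: Comp_arr Comp_assoc_arr) (simp add: Comp_arr Comp_assoc_arr[symmetric] gf Comp_ident_arr)
  show "zero_object C ?W \<or> iso_arr C f"
  proof (cases "?e = Zero C S S")
    case True
    have "Ident C ?W = Comp C (Comp C g f) (Comp C g f)" using gf W by (simp add: lin_simps)
    also have "\<dots> = Comp C g (Comp C ?e f)" using fs gs by (simp add: Comp_arr Comp_assoc_arr)
    also have "\<dots> = Zero C ?W ?W" unfolding True using fs gs W S by (simp add: lin_simps)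
    finally show ?thesis using zero_object_iff[OF W] by blast
  next
    case False
    then obtain y where y: "y \<in> Hom C S S" "Comp C y ?e = Ident C S" using division e by blast
    have "?e = Comp C (Comp C y ?e) ?e" unfolding y(2) by (rule Ident_Comp[OF e, symmetric])
    also have "\<dots> = Comp C y (Comp C ?e ?e)" by (rule Comp_assoc[OF e e y(1), symmetric])
    also have "\<dots> = Ident C S" unfolding ee y(2) ..
    finally show ?thesis using gf g(1) fs unfolding iso_arr_def by auto
  qed
qed

text \<open>
  If \<open>f g f = f\<close>, then splitting the idempotents \<open>1 - g f\<close> and \<open>1 - f g\<close> gives a kernel and a cokernel of
  \<open>f\<close>. A monomorphism \<open>f\<close> is a kernel of \<open>1 - f g\<close>, and an epimorphism \<open>f\<close> is a cokernel of \<open>1 - g f\<close>.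
\<close>

lemma abelian_if_regular:
  assumes add: "additive_category K C" and reg: "\<And>f. f \<in> Arr C \<Longrightarrow> regular_arr f"
    and split: "\<And>A e. A \<in> Obj C \<Longrightarrow> e \<in> Hom C A A \<Longrightarrow> Comp C e e = e \<Longrightarrow>
      \<exists>B \<in> Obj C. \<exists>r \<in> Hom C A B. \<exists>s \<in> Hom C B A. Comp C r s = Ident C B \<and> Comp C s r = e"
  shows "abelian_category K C"
proof -
  have quasi: "\<exists>g. g \<in> Arr C \<and> Dom C g = Cod C f \<and> Cod C g = Dom C f \<and> Comp C f (Comp C g f) = f"
    if "f \<in> Arr C" for f
    using reg[OF that] unfolding regular_arr_def Hom_def by auto
  have ker: "\<exists>k. kernel_of C f k" if f: "f \<in> Arr C" for f
  proof -
    let ?A = "Dom C f" let ?B = "Cod C f"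
    obtain g where g: "g \<in> Arr C" "Dom C g = ?B" "Cod C g = ?A" "Comp C f (Comp C g f) = f"
      using quasi[OF f] by blast
    let ?e = "Plus C (Ident C ?A) (Neg (Comp C g f))"
    have e: "?e \<in> Hom C ?A ?A" using f g(1-3) by (intro HomI) (simp_all add: arr_simps)
    have fe: "Comp C f ?e = Zero C ?A ?B" using f g by (simp add: lin_simps)
    have "Comp C ?e ?e = Plus C ?e (Neg (Comp C g (Comp C f ?e)))"
      using f g(1-3) by (simp add: lin_simps)
    also have "\<dots> = ?e" unfolding fe using f g(1-3) by (simp add: lin_simps)
    finally obtain W r s where W: "W \<in> Obj C" and rs: "r \<in> Hom C ?A W" "s \<in> Hom C W ?A"
        "Comp C r s = Ident C W" "Comp C s r = ?e"
      using split[OF _ e] Dom_in[OF f] by blast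
    have ss: "r \<in> Arr C" "Dom C r = ?A" "Cod C r = W" "s \<in> Arr C" "Dom C s = W" "Cod C s = ?A"
      using rs by (auto simp: Hom_def)
    have "kernel_of C f s"
      unfolding kernel_of_def
    proof (intro conjI ballI impI)
      have "Comp C f s = Comp C (Comp C f (Comp C s r)) s"
        using f ss rs(3) by (simp add: lin_simps)
      then show "Comp C f s = Zero C (Dom C s) ?B"
        unfolding rs(4) fe using f ss by (simp add: lin_simps)
    next
      fix Y h assume Y: "Y \<in> Obj C" and h: "h \<in> Hom C Y ?A" and fh: "Comp C f h = Zero C Y ?B"
      have hs: "h \<in> Arr C" "Dom C h = Y" "Cod C h = ?A" using h by (auto simp: Hom_def)
      have "Comp C s (Comp C r h) = Comp C ?e h"
        unfolding rs(4)[symmetric] using ss hs by (simp add: Comp_assoc_arr)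
      also have "\<dots> = Plus C h (Neg (Comp C g (Comp C f h)))"
        using f g(1-3) hs by (simp add: lin_simps)
      also have "\<dots> = h" unfolding fh using f g(1-3) hs Y by (simp add: lin_simps)
      finally have "Comp C s (Comp C r h) = h" .
      moreover have "Comp C r h \<in> Hom C Y W" using Comp_in h rs(1) by blast
      moreover have "u = Comp C r h" if u: "u \<in> Hom C Y W" "Comp C s u = h" for u
      proof -
        have "Comp C r h = Comp C (Comp C r s) u"
          using u ss by (auto simp: Comp_assoc_arr Hom_def)
        then show ?thesis using rs(3) Ident_Comp[OF u(1)] by simp
      qed
      ultimately show "\<exists>!u. u \<in> Hom C Y (Dom C s) \<and> Comp C s u = h" unfolding ss(5) by blast
    qed (use f ss in simp_all)
    then show ?thesis by blast
  qed
  have coker: "\<exists>q. cokernel_of C f q" if f: "f \<in> Arr C" for f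
  proof -
    let ?A = "Dom C f" let ?B = "Cod C f"
    obtain g where g: "g \<in> Arr C" "Dom C g = ?B" "Cod C g = ?A" "Comp C f (Comp C g f) = f"
      using quasi[OF f] by blast
    let ?e = "Plus C (Ident C ?B) (Neg (Comp C f g))"
    have e: "?e \<in> Hom C ?B ?B" using f g(1-3) by (intro HomI) (simp_all add: arr_simps)
    have ef: "Comp C ?e f = Zero C ?A ?B" using f g by (simp add: lin_simps)
    have "Comp C ?e ?e = Plus C ?e (Neg (Comp C (Comp C ?e f) g))"
      using f g(1-3) by (simp add: lin_simps)
    also have "\<dots> = ?e" unfolding ef using f g(1-3) by (simp add: lin_simps)
    finally obtain W r s where W: "W \<in> Obj C" and rs: "r \<in> Hom C ?B W" "s \<in> Hom C W ?B"
        "Comp C r s = Ident C W" "Comp C s r = ?e"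
      using split[OF _ e] Cod_in[OF f] by blast
    have ss: "r \<in> Arr C" "Dom C r = ?B" "Cod C r = W" "s \<in> Arr C" "Dom C s = W" "Cod C s = ?B"
      using rs by (auto simp: Hom_def)
    have "cokernel_of C f r"
      unfolding cokernel_of_def
    proof (intro conjI ballI impI)
      have "Comp C r f = Comp C (Comp C r s) (Comp C r f)"
        using f ss unfolding rs(3) by (simp add: lin_simps)
      also have "\<dots> = Comp C r (Comp C (Comp C s r) f)"
        using f ss by (simp add: Comp_arr Comp_assoc_arr)
      finally show "Comp C r f = Zero C ?A (Cod C r)"
        unfolding rs(4) ef using f ss by (simp add: lin_simps)
    next
      fix Y h assume Y: "Y \<in> Obj C" and h: "h \<in> Hom C ?B Y" and hf: "Comp C h f = Zero C ?A Y"
      have hs: "h \<in> Arr C" "Dom C h = ?B" "Cod C h = Y" using h by (auto simp: Hom_def)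
      have "Comp C (Comp C h s) r = Comp C h ?e"
        unfolding rs(4)[symmetric] using ss hs by (simp add: Comp_assoc_arr)
      also have "\<dots> = Plus C h (Neg (Comp C (Comp C h f) g))"
        using f g(1-3) hs by (simp add: lin_simps)
      also have "\<dots> = h" unfolding hf using f g(1-3) hs Y by (simp add: lin_simps)
      finally have "Comp C (Comp C h s) r = h" .
      moreover have "Comp C h s \<in> Hom C W Y" using Comp_in h rs(2) by blast
      moreover have "u = Comp C h s" if u: "u \<in> Hom C W Y" "Comp C u r = h" for u
      proof -
        have "Comp C h s = Comp C u (Comp C r s)"
          using u ss by (auto simp: Comp_assoc_arr Hom_def)
        then show ?thesis using rs(3) Comp_Ident[OF u(1)] by simp
      qed
      ultimately show "\<exists>!u. u \<in> Hom C (Cod C r) Y \<and> Comp C u r = h" unfolding ss(3) by blast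
    qed (use f ss in simp_all)
    then show ?thesis by blast
  qed
  have mono: "\<exists>g. kernel_of C g f" if m: "mono_arr C f" for f
  proof -
    have f: "f \<in> Arr C" using m unfolding mono_arr_def by blast
    let ?A = "Dom C f" let ?B = "Cod C f"
    obtain g where g: "g \<in> Arr C" "Dom C g = ?B" "Cod C g = ?A" "Comp C f (Comp C g f) = f"
      using quasi[OF f] by blast
    let ?p = "Plus C (Ident C ?B) (Neg (Comp C f g))"
    have ps: "?p \<in> Arr C" "Dom C ?p = ?B" "Cod C ?p = ?B" using f g(1-3) by (simp_all add: arr_simps)
    have "kernel_of C ?p f"
      unfolding kernel_of_def ps
    proof (intro conjI ballI impI)
      show "Comp C ?p f = Zero C ?A ?B" using f g by (simp add: lin_simps)
    next
      fix Y h assume Y: "Y \<in> Obj C" and h: "h \<in> Hom C Y ?B" and ph: "Comp C ?p h = Zero C Y ?B"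
      have hs: "h \<in> Arr C" "Dom C h = Y" "Cod C h = ?B" using h by (auto simp: Hom_def)
      have "Plus C h (Neg (Comp C f (Comp C g h))) = Zero C Y ?B"
        using ph f g(1-3) hs by (simp add: lin_simps)
      then have "h = Comp C f (Comp C g h)"
        using diff_eq_Zero[of h "Comp C f (Comp C g h)"] f g(1-3) hs by (simp add: arr_simps)
      moreover have "Comp C g h \<in> Hom C Y ?A" using f g(1-3) hs by (intro HomI) (simp_all add: arr_simps)
      ultimately show "\<exists>!u. u \<in> Hom C Y ?A \<and> Comp C f u = h"
        using m Y unfolding mono_arr_def by metis
    qed (use f ps in simp_all)
    then show ?thesis by blast
  qed
  have epi: "\<exists>g. cokernel_of C g f" if m: "epi_arr C f" for f
  proof -
    have f: "f \<in> Arr C" using m unfolding epi_arr_def by blast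
    let ?A = "Dom C f" let ?B = "Cod C f"
    obtain g where g: "g \<in> Arr C" "Dom C g = ?B" "Cod C g = ?A" "Comp C f (Comp C g f) = f"
      using quasi[OF f] by blast
    let ?p = "Plus C (Ident C ?A) (Neg (Comp C g f))"
    have ps: "?p \<in> Arr C" "Dom C ?p = ?A" "Cod C ?p = ?A" using f g(1-3) by (simp_all add: arr_simps)
    have "cokernel_of C ?p f"
      unfolding cokernel_of_def ps
    proof (intro conjI ballI impI)
      show "Comp C f ?p = Zero C ?A ?B" using f g by (simp add: lin_simps)
    next
      fix Y h assume Y: "Y \<in> Obj C" and h: "h \<in> Hom C ?A Y" and hp: "Comp C h ?p = Zero C ?A Y"
      have hs: "h \<in> Arr C" "Dom C h = ?A" "Cod C h = Y" using h by (auto simp: Hom_def)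
      have "Plus C h (Neg (Comp C (Comp C h g) f)) = Zero C ?A Y"
        using hp f g(1-3) hs by (simp add: lin_simps)
      then have "h = Comp C (Comp C h g) f"
        using diff_eq_Zero[of h "Comp C (Comp C h g) f"] f g(1-3) hs by (simp add: arr_simps)
      moreover have "Comp C h g \<in> Hom C ?B Y" using f g(1-3) hs by (intro HomI) (simp_all add: arr_simps)
      ultimately show "\<exists>!u. u \<in> Hom C ?B Y \<and> Comp C u f = h"
        using m Y unfolding epi_arr_def by metis
    qed (use f ps in simp_all)
    then show ?thesis by blast
  qed
  show ?thesis unfolding abelian_category_def using add ker coker mono epi by blast
qed

lemma simple_Hom_one_dim:
  assumes kernels: "\<And>f. f \<in> Arr C \<Longrightarrow> \<exists>k. kernel_of C f k"
    and S: "simple_object C S" and T: "simple_object C T"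
    and scalar: "\<And>x. x \<in> Hom C S S \<Longrightarrow> \<exists>a \<in> carrier K. x = Scale C a (Ident C S)"
  shows "\<exists>h \<in> Hom C S T. \<forall>f \<in> Hom C S T. \<exists>a \<in> carrier K. f = Scale C a h"
proof (cases "\<exists>h \<in> Hom C S T. h \<noteq> Zero C S T")
  case False
  interpret K: field K by (rule field)
  have obj: "S \<in> Obj C" "T \<in> Obj C" using S T unfolding simple_object_def by auto
  have "\<forall>f \<in> Hom C S T. f = Scale C \<one>\<^bsub>K\<^esub> (Zero C S T)" using False Scale_Zero obj by auto
  then show ?thesis using Zero_Hom[OF obj] K.one_closed by blast
next
  case True
  then obtain h where h: "h \<in> Hom C S T" "h \<noteq> Zero C S T" by blast
  obtain g where g: "g \<in> Hom C T S" "Comp C h g = Ident C T"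
    using simple_nonzero_invertible[OF kernels S T h] by blast
  have "\<exists>a \<in> carrier K. f = Scale C a h" if f: "f \<in> Hom C S T" for f
  proof -
    obtain a where a: "a \<in> carrier K" "Comp C g f = Scale C a (Ident C S)"
      using scalar Comp_in f g(1) by blast
    have "f = Comp C (Comp C h g) f" unfolding g(2) by (rule Ident_Comp[OF f, symmetric])
    also have "\<dots> = Comp C h (Scale C a (Ident C S))"
      using Comp_assoc[OF f g(1) h(1)] a(2) by simp
    also have "\<dots> = Scale C a h"
      using Comp_Scale_right[OF Ident_in h(1) a(1)] Comp_Ident[OF h(1)] Hom_Obj[OF h(1)] by simp
    finally show ?thesis using a(1) by blast
  qed
  then show ?thesis using h(1) by blast
qed

lemma fin_dim_Hom:
  assumes kernels: "\<And>f. f \<in> Arr C \<Longrightarrow> \<exists>k. kernel_of C f k"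
    and A: "direct_sum C A Ss" and B: "direct_sum C B Ts"
    and simple: "\<And>S. S \<in> set Ss \<union> set Ts \<Longrightarrow> simple_object C S"
    and scalar: "\<And>S x. S \<in> set Ss \<Longrightarrow> x \<in> Hom C S S \<Longrightarrow> \<exists>a \<in> carrier K. x = Scale C a (Ident C S)"
  shows "vectorspace.fin_dim K (hom_space C A B)"
proof -
  have obj: "A \<in> Obj C" "B \<in> Obj C" using A B unfolding direct_sum_def by auto
  interpret V: vectorspace K "hom_space C A B" using Hom_vectorspace obj by blast
  obtain \<iota> \<pi> where bp: "is_biproduct C A Ss \<iota> \<pi>" using direct_sum_is_biproduct[OF A] .
  obtain \<iota>' \<pi>' where bp': "is_biproduct C B Ts \<iota>' \<pi>'" using direct_sum_is_biproduct[OF B] .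
  have i: "\<iota> k \<in> Hom C (Ss ! k) A" "\<pi> k \<in> Hom C A (Ss ! k)" if "k < length Ss" for k
    using bp that unfolding is_biproduct_def by auto
  have i': "\<iota>' k \<in> Hom C (Ts ! k) B" "\<pi>' k \<in> Hom C B (Ts ! k)" if "k < length Ts" for k
    using bp' that unfolding is_biproduct_def by auto
  have "\<exists>h. h \<in> Hom C S T \<and> (\<forall>f \<in> Hom C S T. \<exists>a \<in> carrier K. f = Scale C a h)"
    if "S \<in> set Ss" "T \<in> set Ts" for S T
    using simple_Hom_one_dim[OF kernels _ _ scalar, of S T] simple that by blast
  then obtain h where h: "\<And>S T. S \<in> set Ss \<Longrightarrow> T \<in> set Ts \<Longrightarrow> h S T \<in> Hom C S T"
      "\<And>S T f. S \<in> set Ss \<Longrightarrow> T \<in> set Ts \<Longrightarrow> f \<in> Hom C S T \<Longrightarrow> \<exists>a \<in> carrier K. f = Scale C a (h S T)"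
    by metis
  define b where "b k l = Comp C (\<iota>' l) (Comp C (h (Ss ! k) (Ts ! l)) (\<pi> k))" for k l
  let ?G = "(\<lambda>(k, l). b k l) ` ({..<length Ss} \<times> {..<length Ts})"
  have b: "b k l \<in> Hom C A B" if "k < length Ss" "l < length Ts" for k l
    unfolding b_def using Comp_in[OF Comp_in[OF i(2) h(1)] i'(1)] that by simp
  then have G: "?G \<subseteq> carrier (hom_space C A B)" by auto
  interpret W: submodule K "V.span ?G" "hom_space C A B" by (rule V.span_is_submodule[OF G])
  have "f \<in> V.span ?G" if f: "f \<in> Hom C A B" for f
  proof (rule biproduct_induct_right[OF bp f, where P = "\<lambda>u. u \<in> V.span ?G"])
    show "Zero C A B \<in> V.span ?G" using W.zero_closed by simp
    fix u v assume "u \<in> V.span ?G" "v \<in> V.span ?G"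
    then show "Plus C u v \<in> V.span ?G" using W.m_closed by simp
  next
    fix k assume k: "k < length Ss"
    let ?f = "Comp C f (Comp C (\<iota> k) (\<pi> k))"
    have fk: "?f \<in> Hom C A B" using Comp_in[OF Comp_in[OF i(2) i(1)] f] k by blast
    show "?f \<in> V.span ?G"
    proof (rule biproduct_induct_left[OF bp' fk, where P = "\<lambda>u. u \<in> V.span ?G"])
      show "Zero C A B \<in> V.span ?G" using W.zero_closed by simp
      fix u v assume "u \<in> V.span ?G" "v \<in> V.span ?G"
      then show "Plus C u v \<in> V.span ?G" using W.m_closed by simp
    next
      fix l assume l: "l < length Ts"
      note ar = i[OF k] i'[OF l] f h(1)[of "Ss ! k" "Ts ! l"]
      let ?m = "Comp C (\<pi>' l) (Comp C f (\<iota> k))"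
      have "?m \<in> Hom C (Ss ! k) (Ts ! l)" using Comp_in[OF Comp_in[OF i(1) f] i'(2)] k l by blast
      then obtain a where a: "a \<in> carrier K" "?m = Scale C a (h (Ss ! k) (Ts ! l))"
        using h(2) k l by (metis nth_mem)
      have "Comp C (Comp C (\<iota>' l) (\<pi>' l)) ?f = Comp C (\<iota>' l) (Comp C ?m (\<pi> k))"
        using ar k l by (simp add: Hom_def Comp_arr Comp_assoc_arr)
      also have "\<dots> = Scale C a (b k l)"
        unfolding a(2) b_def using ar k l a(1) by (simp add: Hom_def Comp_arr Scale_arr Comp_Scale_arr)
      finally have eq: "Comp C (Comp C (\<iota>' l) (\<pi>' l)) ?f = Scale C a (b k l)" .
      have "b k l \<in> V.span ?G" using V.in_own_span[OF G] k l by auto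
      then show "Comp C (Comp C (\<iota>' l) (\<pi>' l)) ?f \<in> V.span ?G"
        unfolding eq using W.smult_closed[OF a(1)] by simp
    qed
  qed
  then have "V.span ?G = carrier (hom_space C A B)" using V.span_is_subset2[OF G] by auto
  moreover have "finite ?G" by simp
  ultimately show ?thesis unfolding V.fin_dim_def using G by blast
qed

end

section \<open>First-order properties of ultraproducts\<close>

context ultrafilter
begin

lemma eventually_not: "(\<forall>\<^sub>F i in U. \<not> P i) \<longleftrightarrow> \<not> (\<forall>\<^sub>F i in U. P i)"
proof -
  have "\<not> ((\<forall>\<^sub>F i in U. P i) \<and> (\<forall>\<^sub>F i in U. \<not> P i))"
  proof
    assume "(\<forall>\<^sub>F i in U. P i) \<and> (\<forall>\<^sub>F i in U. \<not> P i)"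
    then have "\<forall>\<^sub>F i in U. P i \<and> \<not> P i" by (simp only: eventually_conj_iff)
    then show False using proper by simp
  qed
  then show ?thesis using ultra[of P] by blast
qed

lemma eventually_disj: "(\<forall>\<^sub>F i in U. P i \<or> Q i) \<longleftrightarrow> (\<forall>\<^sub>F i in U. P i) \<or> (\<forall>\<^sub>F i in U. Q i)"
proof -
  have "(\<forall>\<^sub>F i in U. \<not> (\<not> P i \<and> \<not> Q i)) \<longleftrightarrow> \<not> (\<not> (\<forall>\<^sub>F i in U. P i) \<and> \<not> (\<forall>\<^sub>F i in U. Q i))"
    unfolding eventually_not eventually_conj_iff ..
  then show ?thesis by simp
qed

lemma eventually_imp: "(\<forall>\<^sub>F i in U. P i \<longrightarrow> Q i) \<longleftrightarrow> ((\<forall>\<^sub>F i in U. P i) \<longrightarrow> (\<forall>\<^sub>F i in U. Q i))"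
  unfolding imp_conv_disj eventually_disj eventually_not ..

text \<open>
  The quantifier steps of the theorem of Los. As the lemmas are applied to concrete formulas, they
  are stated for predicates \<open>P\<close> on the ultraproduct and \<open>Q i\<close> on the factors that are already known to
  correspond. The factors must be nonempty, so that sequences can be completed on the exceptional
  set of indices.
\<close>

lemma Los_ball:
  assumes nonempty: "\<And>i. A i \<noteq> {}"
    and PQ: "\<And>x. (\<And>i. x i \<in> A i) \<Longrightarrow> P (ulim U x) \<longleftrightarrow> (\<forall>\<^sub>F i in U. Q i (x i))"
  shows "(\<forall>x \<in> ultraproduct U A. P x) \<longleftrightarrow> (\<forall>\<^sub>F i in U. \<forall>x \<in> A i. Q i x)"
proof
  assume L: "\<forall>x \<in> ultraproduct U A. P x"
  \<comment> \<open>\<open>x i\<close> is a counterexample to \<open>Q i\<close> wherever there is one.\<close>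
  have "\<exists>x. \<forall>i. x i \<in> A i \<and> (Q i (x i) \<longrightarrow> (\<forall>y \<in> A i. Q i y))"
    by (rule choice) (use nonempty in blast)
  then obtain x where x: "\<And>i. x i \<in> A i" "\<And>i. Q i (x i) \<Longrightarrow> \<forall>y \<in> A i. Q i y" by blast
  then have "P (ulim U x)" using L unfolding ultraproduct_def by blast
  then have "\<forall>\<^sub>F i in U. Q i (x i)" using PQ x(1) by blast
  then show "\<forall>\<^sub>F i in U. \<forall>x \<in> A i. Q i x" by (rule eventually_mono) (rule x(2))
next
  assume R: "\<forall>\<^sub>F i in U. \<forall>x \<in> A i. Q i x"
  show "\<forall>x \<in> ultraproduct U A. P x"
  proof
    fix z assume "z \<in> ultraproduct U A"
    then obtain x where x: "z = ulim U x" "\<And>i. x i \<in> A i" unfolding ultraproduct_def by blast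
    have "\<forall>\<^sub>F i in U. Q i (x i)" using R by (rule eventually_mono) (use x(2) in blast)
    then show "P z" using PQ x by blast
  qed
qed

lemma Los_bex:
  assumes nonempty: "\<And>i. A i \<noteq> {}"
    and PQ: "\<And>x. (\<And>i. x i \<in> A i) \<Longrightarrow> P (ulim U x) \<longleftrightarrow> (\<forall>\<^sub>F i in U. Q i (x i))"
  shows "(\<exists>x \<in> ultraproduct U A. P x) \<longleftrightarrow> (\<forall>\<^sub>F i in U. \<exists>x \<in> A i. Q i x)"
proof -
  have "(\<forall>x \<in> ultraproduct U A. \<not> P x) \<longleftrightarrow> (\<forall>\<^sub>F i in U. \<forall>x \<in> A i. \<not> Q i x)"
    by (rule Los_ball[OF nonempty]) (simp_all add: PQ eventually_not)
  then show ?thesis using eventually_not[of "\<lambda>i. \<exists>x \<in> A i. Q i x"] by auto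
qed

lemma Los_ex1:
  assumes nonempty: "\<And>i. A i \<noteq> {}"
  shows "(\<exists>!x. x \<in> ultraproduct U A) \<longleftrightarrow> (\<forall>\<^sub>F i in U. \<exists>!x. x \<in> A i)"
proof -
  have ex1: "(\<exists>!x. x \<in> S) \<longleftrightarrow> (\<exists>x \<in> S. \<forall>y \<in> S. y = x)" for S :: "'x set"
    unfolding Ex1_def Bex_def Ball_def ..
  show ?thesis
    unfolding ex1
  proof (rule Los_bex[OF nonempty])
    fix x
    show "(\<forall>y \<in> ultraproduct U A. y = ulim U x) \<longleftrightarrow> (\<forall>\<^sub>F i in U. \<forall>y \<in> A i. y = x i)"
      by (rule Los_ball[OF nonempty]) (rule ulim_eq_iff)
  qed
qed

end

text \<open>
  A family of linear categories with an ultrafilter on its index set. Every factor has an object, as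
  the quantifier steps require nonempty sets.
\<close>

locale ultraproduct_of_categories = ultrafilter U
  for U :: "'i filter" +
  fixes K :: "'i \<Rightarrow> 'k ring" and C :: "'i \<Rightarrow> ('o, 'm, 'k) lincat"
  assumes category: "linear_category (K i) (C i)"
    and Obj_nonempty: "Obj (C i) \<noteq> {}"
begin

abbreviation UC :: "(('i \<Rightarrow> 'o) set, ('i \<Rightarrow> 'm) set, ('i \<Rightarrow> 'k) set) lincat" where
  "UC \<equiv> ultraproduct_cat U C"

lemma UC_sets:
  "Obj UC = ultraproduct U (\<lambda>i. Obj (C i))"
  "Arr UC = ultraproduct U (\<lambda>i. Arr (C i))"
  by (simp_all add: ultraproduct_cat_def)

lemma UC_ops:
  "Dom UC (ulim U f) = ulim U (\<lambda>i. Dom (C i) (f i))"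
  "Cod UC (ulim U f) = ulim U (\<lambda>i. Cod (C i) (f i))"
  "Ident UC (ulim U A) = ulim U (\<lambda>i. Ident (C i) (A i))"
  "Comp UC (ulim U g) (ulim U f) = ulim U (\<lambda>i. Comp (C i) (g i) (f i))"
  "Zero UC (ulim U A) (ulim U B) = ulim U (\<lambda>i. Zero (C i) (A i) (B i))"
  "Scale UC (ulim U a) (ulim U f) = ulim U (\<lambda>i. Scale (C i) (a i) (f i))"
  by (simp_all add: ultraproduct_cat_def ulift_ulim ulift2_ulim)

lemma ulim_mem: "(\<And>i. a i \<in> A i) \<Longrightarrow> ulim U a \<in> ultraproduct U A"
  unfolding ultraproduct_def by blast

lemma Arr_nonempty: "Arr (C i) \<noteq> {}"
  using linear_category.Ident_in[OF category] Obj_nonempty unfolding Hom_def by blast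

lemma Hom_nonempty: "A \<in> Obj (C i) \<Longrightarrow> B \<in> Obj (C i) \<Longrightarrow> Hom (C i) A B \<noteq> {}"
  using linear_category.Zero_Hom[OF category] by blast

text \<open>
  Arrows of the ultraproduct have the right domain and codomain only almost everywhere; replacing
  the exceptional terms by zero arrows gives representatives that are typed correctly everywhere.
\<close>

lemma Hom_UC:
  assumes A: "\<And>i. A i \<in> Obj (C i)" and B: "\<And>i. B i \<in> Obj (C i)"
  shows "Hom UC (ulim U A) (ulim U B) = ultraproduct U (\<lambda>i. Hom (C i) (A i) (B i))"
proof (rule Set.set_eqI, rule iffI)
  fix f assume "f \<in> Hom UC (ulim U A) (ulim U B)"
  then have f: "f \<in> Arr UC" "Dom UC f = ulim U A" "Cod UC f = ulim U B" by (simp_all add: Hom_def)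
  then obtain g where g: "f = ulim U g" "\<And>i. g i \<in> Arr (C i)"
    unfolding UC_sets ultraproduct_def by blast
  have gDC: "\<forall>\<^sub>F i in U. Dom (C i) (g i) = A i" "\<forall>\<^sub>F i in U. Cod (C i) (g i) = B i"
    using f(2,3) unfolding g(1) UC_ops ulim_eq_iff .
  let ?h = "\<lambda>i. if g i \<in> Hom (C i) (A i) (B i) then g i else Zero (C i) (A i) (B i)"
  have "\<forall>\<^sub>F i in U. g i = ?h i"
    using gDC by (rule eventually_elim2) (use g(2) in \<open>simp add: Hom_def\<close>)
  then have "f = ulim U ?h" unfolding g(1) by (simp only: ulim_eq_iff)
  moreover have "?h i \<in> Hom (C i) (A i) (B i)" for i
    using linear_category.Zero_Hom[OF category A B] by simp
  ultimately show "f \<in> ultraproduct U (\<lambda>i. Hom (C i) (A i) (B i))"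
    using ulim_mem[of ?h "\<lambda>i. Hom (C i) (A i) (B i)"] by simp
next
  fix f assume "f \<in> ultraproduct U (\<lambda>i. Hom (C i) (A i) (B i))"
  then obtain g where "f = ulim U g" "\<And>i. g i \<in> Hom (C i) (A i) (B i)"
    unfolding ultraproduct_def by blast
  then show "f \<in> Hom UC (ulim U A) (ulim U B)"
    using ulim_mem[of g "\<lambda>i. Arr (C i)"] by (simp add: Hom_def UC_sets UC_ops)
qed

lemma Los_zero_object:
  assumes A: "\<And>i. A i \<in> Obj (C i)"
  shows "zero_object UC (ulim U A) \<longleftrightarrow> (\<forall>\<^sub>F i in U. zero_object (C i) (A i))"
proof -
  have "(\<forall>B \<in> Obj UC. (\<exists>!f. f \<in> Hom UC (ulim U A) B) \<and> (\<exists>!f. f \<in> Hom UC B (ulim U A))) \<longleftrightarrow>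
    (\<forall>\<^sub>F i in U. \<forall>B \<in> Obj (C i). (\<exists>!f. f \<in> Hom (C i) (A i) B) \<and> (\<exists>!f. f \<in> Hom (C i) B (A i)))"
    unfolding UC_sets
    by (rule Los_ball[OF Obj_nonempty]) (simp add: Hom_UC A Los_ex1 Hom_nonempty eventually_conj_iff)
  then show ?thesis
    unfolding zero_object_def using A by (simp add: UC_sets ulim_mem)
qed

lemma Los_mono_arr:
  assumes f: "\<And>i. f i \<in> Arr (C i)"
  shows "mono_arr UC (ulim U f) \<longleftrightarrow> (\<forall>\<^sub>F i in U. mono_arr (C i) (f i))"
proof -
  have D: "Dom (C i) (f i) \<in> Obj (C i)" for i
    using linear_category.Dom_in[OF category f] .
  have "(\<forall>W \<in> Obj UC. \<forall>g \<in> Hom UC W (Dom UC (ulim U f)). \<forall>h \<in> Hom UC W (Dom UC (ulim U f)).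
      Comp UC (ulim U f) g = Comp UC (ulim U f) h \<longrightarrow> g = h) \<longleftrightarrow>
    (\<forall>\<^sub>F i in U. \<forall>W \<in> Obj (C i). \<forall>g \<in> Hom (C i) W (Dom (C i) (f i)). \<forall>h \<in> Hom (C i) W (Dom (C i) (f i)).
      Comp (C i) (f i) g = Comp (C i) (f i) h \<longrightarrow> g = h)"
    unfolding UC_sets
  proof (rule Los_ball[OF Obj_nonempty])
    fix W assume W: "\<And>i. W i \<in> Obj (C i)"
    show "(\<forall>g \<in> Hom UC (ulim U W) (Dom UC (ulim U f)). \<forall>h \<in> Hom UC (ulim U W) (Dom UC (ulim U f)).
        Comp UC (ulim U f) g = Comp UC (ulim U f) h \<longrightarrow> g = h) \<longleftrightarrow>
      (\<forall>\<^sub>F i in U. \<forall>g \<in> Hom (C i) (W i) (Dom (C i) (f i)). \<forall>h \<in> Hom (C i) (W i) (Dom (C i) (f i)).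
        Comp (C i) (f i) g = Comp (C i) (f i) h \<longrightarrow> g = h)"
      unfolding UC_ops Hom_UC[OF W D]
      by (intro Los_ball Hom_nonempty W D) (simp add: UC_ops ulim_eq_iff eventually_imp)
  qed
  then show ?thesis
    unfolding mono_arr_def using f by (simp add: UC_sets(2) ulim_mem)
qed

lemma Los_iso_arr:
  assumes f: "\<And>i. f i \<in> Arr (C i)"
  shows "iso_arr UC (ulim U f) \<longleftrightarrow> (\<forall>\<^sub>F i in U. iso_arr (C i) (f i))"
proof -
  have D: "Dom (C i) (f i) \<in> Obj (C i)" "Cod (C i) (f i) \<in> Obj (C i)" for i
    using linear_category.Dom_in[OF category f] linear_category.Cod_in[OF category f] .
  have "(\<exists>g \<in> Hom UC (Cod UC (ulim U f)) (Dom UC (ulim U f)).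
      Comp UC g (ulim U f) = Ident UC (Dom UC (ulim U f)) \<and>
      Comp UC (ulim U f) g = Ident UC (Cod UC (ulim U f))) \<longleftrightarrow>
    (\<forall>\<^sub>F i in U. \<exists>g \<in> Hom (C i) (Cod (C i) (f i)) (Dom (C i) (f i)).
      Comp (C i) g (f i) = Ident (C i) (Dom (C i) (f i)) \<and>
      Comp (C i) (f i) g = Ident (C i) (Cod (C i) (f i)))"
    unfolding UC_ops Hom_UC[OF D(2) D(1)]
    by (intro Los_bex Hom_nonempty D) (simp add: UC_ops ulim_eq_iff eventually_conj_iff)
  then show ?thesis
    unfolding iso_arr_def using f by (simp add: UC_sets(2) ulim_mem)
qed

text \<open>
  Simplicity is a first-order property of an object of a category.
\<close>

lemma Los_simple_object:
  assumes A: "\<And>i. A i \<in> Obj (C i)"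
  shows "simple_object UC (ulim U A) \<longleftrightarrow> (\<forall>\<^sub>F i in U. simple_object (C i) (A i))"
proof -
  have arr: "simple_object Q B \<longleftrightarrow> B \<in> Obj Q \<and> \<not> zero_object Q B \<and>
      (\<forall>f \<in> Arr Q. mono_arr Q f \<and> Cod Q f = B \<longrightarrow> zero_object Q (Dom Q f) \<or> iso_arr Q f)"
    for Q :: "('x, 'y, 'z) lincat" and B
    unfolding simple_object_def mono_arr_def by blast
  have "(\<forall>f \<in> Arr UC. mono_arr UC f \<and> Cod UC f = ulim U A \<longrightarrow> zero_object UC (Dom UC f) \<or> iso_arr UC f) \<longleftrightarrow>
    (\<forall>\<^sub>F i in U. \<forall>f \<in> Arr (C i). mono_arr (C i) f \<and> Cod (C i) f = A i \<longrightarrow>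
      zero_object (C i) (Dom (C i) f) \<or> iso_arr (C i) f)"
    unfolding UC_sets(2)
  proof (rule Los_ball[OF Arr_nonempty])
    fix f assume f: "\<And>i. f i \<in> Arr (C i)"
    have D: "Dom (C i) (f i) \<in> Obj (C i)" for i
      using linear_category.Dom_in[OF category f] .
    show "(mono_arr UC (ulim U f) \<and> Cod UC (ulim U f) = ulim U A \<longrightarrow>
        zero_object UC (Dom UC (ulim U f)) \<or> iso_arr UC (ulim U f)) \<longleftrightarrow>
      (\<forall>\<^sub>F i in U. mono_arr (C i) (f i) \<and> Cod (C i) (f i) = A i \<longrightarrow>
        zero_object (C i) (Dom (C i) (f i)) \<or> iso_arr (C i) (f i))"
      unfolding UC_ops Los_mono_arr[OF f] Los_iso_arr[OF f] Los_zero_object[OF D]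
        ulim_eq_iff eventually_imp eventually_disj eventually_conj_iff ..
  qed
  then show ?thesis
    unfolding arr using A
    by (simp add: UC_sets(1) ulim_mem Los_zero_object eventually_conj_iff eventually_not)
qed

end

section \<open>Ultraproducts of semisimple categories\<close>

locale ultraproduct_of_semisimple = ultraproduct_of_categories U K C
  for U :: "'i filter" and K :: "'i \<Rightarrow> 'k ring" and C :: "'i \<Rightarrow> ('o, 'm, 'k) lincat" +
  assumes alg_closed: "algebraically_closed (K i)"
    and semisimple: "semisimple_category (K i) (C i)"
begin

abbreviation UK :: "('i \<Rightarrow> 'k) set ring" where
  "UK \<equiv> ultraproduct_ring U K"

lemma UC_regular:
  assumes f: "f \<in> Arr UC"
  shows "\<exists>g \<in> Hom UC (Cod UC f) (Dom UC f). Comp UC f (Comp UC g f) = f"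
proof -
  obtain f' where f': "f = ulim U f'" "\<And>i. f' i \<in> Arr (C i)"
    using f unfolding UC_sets ultraproduct_def by blast
  have D: "Dom (C i) (f' i) \<in> Obj (C i)" "Cod (C i) (f' i) \<in> Obj (C i)" for i
    using linear_category.Dom_in[OF category f'(2)] linear_category.Cod_in[OF category f'(2)] .
  have "linear_category.regular_arr (C i) (f' i)" for i
  proof (rule linear_category.semisimple_regular[OF category])
    show "\<exists>k. kernel_of (C i) f k" if "f \<in> Arr (C i)" for f
      using semisimple[of i] that unfolding semisimple_category_def abelian_category_def by blast
    show "\<exists>Ss. (\<forall>S \<in> set Ss. simple_object (C i) S) \<and> direct_sum (C i) A Ss" if "A \<in> Obj (C i)" for A
      using semisimple[of i] that unfolding semisimple_category_def by blast
    show "f' i \<in> Hom (C i) (Dom (C i) (f' i)) (Cod (C i) (f' i))" using f'(2) by (simp add: Hom_def)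
  qed
  then have "\<forall>i. \<exists>g \<in> Hom (C i) (Cod (C i) (f' i)) (Dom (C i) (f' i)).
      Comp (C i) (f' i) (Comp (C i) g (f' i)) = f' i"
    unfolding linear_category.regular_arr_def[OF category] by blast
  then obtain g where g: "\<And>i. g i \<in> Hom (C i) (Cod (C i) (f' i)) (Dom (C i) (f' i))"
      "\<And>i. Comp (C i) (f' i) (Comp (C i) (g i) (f' i)) = f' i"
    by metis
  have "ulim U g \<in> Hom UC (Cod UC f) (Dom UC f)"
    unfolding f'(1) UC_ops Hom_UC[OF D(2) D(1)] by (rule ulim_mem) (rule g(1))
  moreover have "Comp UC f (Comp UC (ulim U g) f) = f"
    unfolding f'(1) UC_ops g(2) ..
  ultimately show ?thesis by blast
qed

text \<open>
  Schur's lemma in the ultraproduct. The Hom spaces there need not be finite-dimensional, so the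
  lemma is applied in almost every factor, where the endomorphisms of the component of \<open>S\<close> again
  form a division algebra, and the scalars found there are collected.
\<close>

lemma UC_Schur:
  assumes S: "S \<in> Obj UC" and nz: "Ident UC S \<noteq> Zero UC S S"
    and division: "\<forall>x \<in> Hom UC S S. x \<noteq> Zero UC S S \<longrightarrow> (\<exists>y \<in> Hom UC S S. Comp UC y x = Ident UC S)"
    and x: "x \<in> Hom UC S S"
  shows "\<exists>a \<in> carrier UK. x = Scale UC a (Ident UC S)"
proof -
  obtain T where T: "S = ulim U T" "\<And>i. T i \<in> Obj (C i)"
    using S unfolding UC_sets ultraproduct_def by blast
  obtain y where y: "x = ulim U y" "\<And>i. y i \<in> Hom (C i) (T i) (T i)"
    using x unfolding T(1) Hom_UC[OF T(2) T(2)] ultraproduct_def by blast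
  have nz': "\<forall>\<^sub>F i in U. Ident (C i) (T i) \<noteq> Zero (C i) (T i) (T i)"
    using nz unfolding T(1) UC_ops ulim_eq_iff eventually_not .
  have "(\<forall>x \<in> Hom UC S S. x \<noteq> Zero UC S S \<longrightarrow> (\<exists>y \<in> Hom UC S S. Comp UC y x = Ident UC S)) \<longleftrightarrow>
    (\<forall>\<^sub>F i in U. \<forall>x \<in> Hom (C i) (T i) (T i). x \<noteq> Zero (C i) (T i) (T i) \<longrightarrow>
      (\<exists>y \<in> Hom (C i) (T i) (T i). Comp (C i) y x = Ident (C i) (T i)))"
    unfolding T(1) Hom_UC[OF T(2) T(2)]
  proof (rule Los_ball[OF Hom_nonempty[OF T(2) T(2)]])
    fix x assume x: "\<And>i. x i \<in> Hom (C i) (T i) (T i)"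
    have "(\<exists>y \<in> ultraproduct U (\<lambda>i. Hom (C i) (T i) (T i)). Comp UC y (ulim U x) = Ident UC (ulim U T)) \<longleftrightarrow>
      (\<forall>\<^sub>F i in U. \<exists>y \<in> Hom (C i) (T i) (T i). Comp (C i) y (x i) = Ident (C i) (T i))"
      by (rule Los_bex[OF Hom_nonempty[OF T(2) T(2)]]) (simp add: UC_ops ulim_eq_iff)
    then show "(ulim U x \<noteq> Zero UC (ulim U T) (ulim U T) \<longrightarrow>
        (\<exists>y \<in> ultraproduct U (\<lambda>i. Hom (C i) (T i) (T i)). Comp UC y (ulim U x) = Ident UC (ulim U T))) \<longleftrightarrow>
      (\<forall>\<^sub>F i in U. x i \<noteq> Zero (C i) (T i) (T i) \<longrightarrow>
        (\<exists>y \<in> Hom (C i) (T i) (T i). Comp (C i) y (x i) = Ident (C i) (T i)))"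
      by (simp add: UC_ops ulim_eq_iff eventually_imp eventually_not)
  qed
  then have "\<forall>\<^sub>F i in U. \<forall>x \<in> Hom (C i) (T i) (T i). x \<noteq> Zero (C i) (T i) (T i) \<longrightarrow>
      (\<exists>y \<in> Hom (C i) (T i) (T i). Comp (C i) y x = Ident (C i) (T i))"
    using division by blast
  then have scalar: "\<forall>\<^sub>F i in U. \<exists>a \<in> carrier (K i). y i = Scale (C i) a (Ident (C i) (T i))"
    using nz'
  proof (rule eventually_elim2)
    fix i
    assume "\<forall>x \<in> Hom (C i) (T i) (T i). x \<noteq> Zero (C i) (T i) (T i) \<longrightarrow>
      (\<exists>y \<in> Hom (C i) (T i) (T i). Comp (C i) y x = Ident (C i) (T i))"
      and nz: "Ident (C i) (T i) \<noteq> Zero (C i) (T i) (T i)"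
    moreover have "vectorspace.fin_dim (K i) (hom_space (C i) (T i) (T i))"
      using semisimple[of i] T(2) unfolding semisimple_category_def by blast
    ultimately show "\<exists>a \<in> carrier (K i). y i = Scale (C i) a (Ident (C i) (T i))"
      using linear_category.Schur[OF category T(2) alg_closed _ nz _ y(2)] by blast
  qed
  have "\<exists>a. \<forall>i. a i \<in> carrier (K i) \<and>
      ((\<exists>a \<in> carrier (K i). y i = Scale (C i) a (Ident (C i) (T i))) \<longrightarrow>
        y i = Scale (C i) (a i) (Ident (C i) (T i)))"
  proof (rule choice, rule allI)
    fix i
    interpret field "K i" using linear_category.field[OF category] .
    show "\<exists>a. a \<in> carrier (K i) \<and>
      ((\<exists>a \<in> carrier (K i). y i = Scale (C i) a (Ident (C i) (T i))) \<longrightarrow>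
        y i = Scale (C i) a (Ident (C i) (T i)))"
      using zero_closed by blast
  qed
  then obtain a where a: "\<And>i. a i \<in> carrier (K i)"
      "\<And>i. \<exists>a \<in> carrier (K i). y i = Scale (C i) a (Ident (C i) (T i)) \<Longrightarrow>
        y i = Scale (C i) (a i) (Ident (C i) (T i))"
    by blast
  have "\<forall>\<^sub>F i in U. y i = Scale (C i) (a i) (Ident (C i) (T i))"
    using scalar by (rule eventually_mono) (rule a(2))
  then have "x = Scale UC (ulim U a) (Ident UC S)"
    unfolding y(1) T(1) UC_ops ulim_eq_iff .
  moreover have "ulim U a \<in> carrier UK"
    using ulim_mem[of a "\<lambda>i. carrier (K i)"] a(1) by (simp add: ultraproduct_ring_def)
  ultimately show ?thesis by blast
qed

lemma full_subcategory_semisimple: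
  assumes full: "full_linear_subcategory UK D UC" and karoubi: "karoubian UK D"
    and ks: "krull_schmidt D"
  shows "semisimple_category UK D"
proof -
  have sub: "linear_subcategory UK D UC" and Hom: "\<And>A B. A \<in> Obj D \<Longrightarrow> B \<in> Obj D \<Longrightarrow> Hom D A B = Hom UC A B"
    using full unfolding full_linear_subcategory_def by auto
  interpret D: linear_category UK D using sub unfolding linear_subcategory_def by blast
  have obj: "A \<in> Obj D \<Longrightarrow> A \<in> Obj UC" and arr: "f \<in> Arr D \<Longrightarrow> f \<in> Arr UC"
    and DomCod: "f \<in> Arr D \<Longrightarrow> Dom D f = Dom UC f" "f \<in> Arr D \<Longrightarrow> Cod D f = Cod UC f"
    and Ident: "A \<in> Obj D \<Longrightarrow> Ident D A = Ident UC A"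
    and Comp: "f \<in> Arr D \<Longrightarrow> g \<in> Arr D \<Longrightarrow> Dom D g = Cod D f \<Longrightarrow> Comp D g f = Comp UC g f"
    and Zero: "A \<in> Obj D \<Longrightarrow> B \<in> Obj D \<Longrightarrow> Zero D A B = Zero UC A B"
    and Scale: "a \<in> carrier UK \<Longrightarrow> f \<in> Arr D \<Longrightarrow> Scale D a f = Scale UC a f"
    for A B a f g
    using sub unfolding linear_subcategory_def by auto
  have CompH: "Comp D g f = Comp UC g f" if "f \<in> Hom D A B" "g \<in> Hom D B E" for f g A B E
    using Comp[of f g] that by (simp add: Hom_def)
  have reg: "D.regular_arr f" if f: "f \<in> Arr D" for f
  proof -
    have AB: "Dom D f \<in> Obj D" "Cod D f \<in> Obj D" using f D.Dom_in D.Cod_in by auto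
    obtain g where g: "g \<in> Hom UC (Cod UC f) (Dom UC f)" "Comp UC f (Comp UC g f) = f"
      using UC_regular arr f by blast
    have g': "g \<in> Hom D (Cod D f) (Dom D f)" using g(1) Hom[OF AB(2,1)] DomCod f by simp
    have f': "f \<in> Hom D (Dom D f) (Cod D f)" using f by (simp add: Hom_def)
    have "Comp D f (Comp D g f) = f"
      using g(2) CompH[OF f' g'] CompH[OF D.Comp_in[OF f' g'] f'] by simp
    then show ?thesis unfolding D.regular_arr_def using g' by blast
  qed
  have abelian: "abelian_category UK D"
    by (rule D.abelian_if_regular[OF _ reg]) (use karoubi in \<open>auto simp: karoubian_def\<close>)
  then have kernels: "\<exists>k. kernel_of D f k" if "f \<in> Arr D" for f
    using that unfolding abelian_category_def by blast
  \<comment> \<open>A local endomorphism ring is a division ring, as all its elements are regular.\<close>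
  have local: "Ident D S \<noteq> Zero D S S \<and>
      (\<forall>x \<in> Hom D S S. x \<noteq> Zero D S S \<longrightarrow> (\<exists>y \<in> Hom D S S. Comp D y x = Ident D S))"
    if S: "S \<in> Obj D" and loc: "local_ring (hom_space D S S)" for S
  proof (intro conjI ballI impI)
    interpret R: ring "hom_space D S S" by (rule D.End_ring[OF S])
    interpret N: ideal "carrier (hom_space D S S) - Units (hom_space D S S)" "hom_space D S S"
      using loc unfolding local_ring_def by blast
    have "Zero D S S \<notin> Units (hom_space D S S)"
      using additive_subgroup.zero_closed[OF N.is_additive_subgroup] by simp
    then show "Ident D S \<noteq> Zero D S S" using R.Units_one_closed by auto
    fix x assume x: "x \<in> Hom D S S" "x \<noteq> Zero D S S"
    then have xs: "x \<in> Arr D" "Dom D x = S" "Cod D x = S" by (auto simp: Hom_def)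
    obtain y where "y \<in> Hom D S S" "Comp D x (Comp D y x) = x"
      using reg[OF xs(1)] xs unfolding D.regular_arr_def by auto
    then have "x \<in> Units (hom_space D S S)"
      using R.local_regular_unit[OF loc, of x y] x by simp
    then show "\<exists>y \<in> Hom D S S. Comp D y x = Ident D S" unfolding Units_def by auto
  qed
  have decomp: "\<exists>Ss. direct_sum D A Ss \<and> (\<forall>S \<in> set Ss. simple_object D S \<and>
      (\<forall>x \<in> Hom D S S. \<exists>a \<in> carrier UK. x = Scale D a (Ident D S)))" if A: "A \<in> Obj D" for A
  proof -
    obtain Ss where "krull_schmidt_decomp D A Ss" using ks A unfolding krull_schmidt_def by blast
    then have Ss: "direct_sum D A Ss" "\<And>S. S \<in> set Ss \<Longrightarrow> S \<in> Obj D"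
        "\<And>S. S \<in> set Ss \<Longrightarrow> local_ring (hom_space D S S)"
      unfolding krull_schmidt_decomp_def direct_sum_def by auto
    have "simple_object D S \<and> (\<forall>x \<in> Hom D S S. \<exists>a \<in> carrier UK. x = Scale D a (Ident D S))"
      if "S \<in> set Ss" for S
    proof -
      have S: "S \<in> Obj D" using Ss(2) that .
      have nz: "Ident D S \<noteq> Zero D S S"
        and div: "\<forall>x \<in> Hom D S S. x \<noteq> Zero D S S \<longrightarrow> (\<exists>y \<in> Hom D S S. Comp D y x = Ident D S)"
        using local[OF S Ss(3)[OF that]] by auto
      have nzU: "Ident UC S \<noteq> Zero UC S S" using nz Ident[OF S] Zero[OF S S] by simp
      have divU: "\<forall>x \<in> Hom UC S S. x \<noteq> Zero UC S S \<longrightarrow> (\<exists>y \<in> Hom UC S S. Comp UC y x = Ident UC S)"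
      proof (intro ballI impI)
        fix x assume "x \<in> Hom UC S S" and x0: "x \<noteq> Zero UC S S"
        then have x: "x \<in> Hom D S S" using Hom[OF S S] by simp
        have "x \<noteq> Zero D S S" unfolding Zero[OF S S] by (rule x0)
        then obtain y where y: "y \<in> Hom D S S" "Comp D y x = Ident D S"
          using bspec[OF div x] by blast
        have "Comp UC y x = Ident UC S" using CompH[OF x y(1)] Ident[OF S] y(2) by simp
        then show "\<exists>y \<in> Hom UC S S. Comp UC y x = Ident UC S"
          using y(1) unfolding Hom[OF S S] by (rule bexI)
      qed
      have "simple_object D S"
        using D.simple_if_division[OF reg S nz] div by blast
      moreover have "\<exists>a \<in> carrier UK. x = Scale D a (Ident D S)" if x: "x \<in> Hom D S S" for x
      proof -
        obtain a where a: "a \<in> carrier UK" "x = Scale UC a (Ident UC S)"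
          using UC_Schur[OF obj[OF S] nzU divU] x unfolding Hom[OF S S] by blast
        have "x = Scale D a (Ident D S)"
          using a Scale[OF a(1), of "Ident D S"] Ident[OF S] D.Ident_arr(1)[OF S] by simp
        then show ?thesis using a(1) by blast
      qed
      ultimately show ?thesis by blast
    qed
    then show ?thesis using Ss(1) by blast
  qed
  have "vectorspace.fin_dim UK (hom_space D A B)" if A: "A \<in> Obj D" and B: "B \<in> Obj D" for A B
  proof -
    obtain Ss where Ss: "direct_sum D A Ss" "\<forall>S \<in> set Ss. simple_object D S \<and>
        (\<forall>x \<in> Hom D S S. \<exists>a \<in> carrier UK. x = Scale D a (Ident D S))"
      using decomp[OF A] by (elim exE conjE)
    obtain Ts where Ts: "direct_sum D B Ts" "\<forall>S \<in> set Ts. simple_object D S \<and>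
        (\<forall>x \<in> Hom D S S. \<exists>a \<in> carrier UK. x = Scale D a (Ident D S))"
      using decomp[OF B] by (elim exE conjE)
    show ?thesis
    proof (rule D.fin_dim_Hom[OF kernels Ss(1) Ts(1)])
      show "simple_object D S" if "S \<in> set Ss \<union> set Ts" for S
        using that conjunct1[OF bspec[OF Ss(2)]] conjunct1[OF bspec[OF Ts(2)]] by (elim UnE)
      show "\<exists>a \<in> carrier UK. x = Scale D a (Ident D S)" if "S \<in> set Ss" "x \<in> Hom D S S" for S x
        using bspec[OF conjunct2[OF bspec[OF Ss(2) that(1)]] that(2)] .
    qed
  qed
  moreover have "\<exists>Ss. (\<forall>S \<in> set Ss. simple_object D S) \<and> direct_sum D A Ss" if A: "A \<in> Obj D" for A
  proof -
    obtain Ss where Ss: "direct_sum D A Ss" "\<forall>S \<in> set Ss. simple_object D S \<and>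
        (\<forall>x \<in> Hom D S S. \<exists>a \<in> carrier UK. x = Scale D a (Ident D S))"
      using decomp[OF A] by (elim exE conjE)
    show ?thesis
      using Ss(1) conjunct1[OF bspec[OF Ss(2)]] by (intro exI[of _ Ss] conjI ballI)
  qed
  ultimately show ?thesis unfolding semisimple_category_def using abelian by (intro conjI ballI)
qed

end

theorem propositionA26:
  fixes U :: "nat filter"
    and K :: "nat \<Rightarrow> 'k ring"
    and C :: "nat \<Rightarrow> ('o, 'm, 'k) lincat"
  assumes "ultrafilter U"
    and "\<And>i. algebraically_closed (K i)"
    and "algebraically_closed (ultraproduct_ring U K)"
    and "\<And>i. semisimple_category (K i) (C i)"
  shows "(\<forall>D. full_linear_subcategory (ultraproduct_ring U K) D (ultraproduct_cat U C) \<and>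
              karoubian (ultraproduct_ring U K) D \<and> krull_schmidt D \<longrightarrow>
              semisimple_category (ultraproduct_ring U K) D) \<and>
         (\<forall>A. (\<forall>i. A i \<in> Obj (C i)) \<longrightarrow>
              (simple_object (ultraproduct_cat U C) (ulim U A) \<longleftrightarrow>
               (\<forall>\<^sub>F i in U. simple_object (C i) (A i))))"
proof -
  have additive: "additive_category (K i) (C i)" for i
    using assms(4)[of i] unfolding semisimple_category_def abelian_category_def by blast
  have linear: "linear_category (K i) (C i)" for i
    using additive[of i] unfolding additive_category_def by blast
  have nonempty: "Obj (C i) \<noteq> {}" for i
  proof -
    have "\<exists>A. direct_sum (C i) A []"
      using conjunct2[OF additive[of i, unfolded additive_category_def]]
      by (elim allE[of _ "[]"]) simp
    then show ?thesis unfolding direct_sum_def by blast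
  qed
  interpret ultraproduct_of_semisimple U K C
    by (intro ultraproduct_of_semisimple.intro ultraproduct_of_categories.intro ultraproduct_of_categories_axioms.intro ultraproduct_of_semisimple_axioms.intro assms(1,2,4) linear nonempty)
  show ?thesis
  proof (intro conjI allI impI)
    fix D
    assume "full_linear_subcategory UK D UC \<and> karoubian UK D \<and> krull_schmidt D"
    then show "semisimple_category UK D"
      by (elim conjE) (rule full_subcategory_semisimple)
  next
    fix A
    assume "\<forall>i. A i \<in> Obj (C i)"
    then show "simple_object UC (ulim U A) \<longleftrightarrow> (\<forall>\<^sub>F i in U. simple_object (C i) (A i))"
      by (intro Los_simple_object) (rule spec)
  qed
qed

end
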